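(* Let $\Omega^{(2)}_n$ denote the polytope of all $n\times n\times n$ arrays of nonnegative real numbers in which every line sums to $1$, and let $L_n$ denote the number of Latin squares of order $n$. Then the number of vertices of $\Omega^{(2)}_n$ is at least $L_n^{\frac{3}{2}-o(1)}$, where $o(1)$ denotes a quantity tending to $0$ as $n\to\infty$.
   Context: A line in an $n\times n\times n$ array $A$ is a set of $n$ entries obtained by fixing two of the three indices and letting the third range over $\{1,\dots,n\}$ (i.e. $A(\cdot,j,k)$, $A(i,\cdot,k)$ or $A(i,j,\cdot)$). Arrays in $\Omega^{(2)}_n$ are called tristochastic. A Latin square of order $n$ is an $n\times n$ matrix with entries in $\{1,\dots,n\}$ in which each symbol appears exactly once in every row and every column. *)

theory Defs
  imports "HOL-Analysis.Analysis" "HOL-Analysis.Finite_Function_Topology"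
begin

text \<open>
  Since \<open>n\<close> varies, \<open>n \<times> n \<times> n\<close> real arrays are the finitely supported functions on triples
  of naturals that vanish outside \<open>{1..n} \<times> {1..n} \<times> {1..n}\<close>. They form a linear subspace of the
  real vector space \<open>nat \<times> nat \<times> nat \<Rightarrow>\<^sub>0 real\<close>, isomorphic to the space of
  all such arrays, so the library notion of extreme point applies.
\<close>

type_synonym array3 = "nat \<times> nat \<times> nat \<Rightarrow>\<^sub>0 real"

definition arrays3 :: "nat \<Rightarrow> array3 set" where
  "arrays3 n = {A. Poly_Mapping.keys A \<subseteq> {1..n} \<times> {1..n} \<times> {1..n}}"

definition tristochastic :: "nat \<Rightarrow> array3 set" where
  "tristochastic n = {A \<in> arrays3 n.
     (\<forall>i\<in>{1..n}. \<forall>j\<in>{1..n}. \<forall>k\<in>{1..n}. 0 \<le> Poly_Mapping.lookup A (i, j, k)) \<and>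
     (\<forall>j\<in>{1..n}. \<forall>k\<in>{1..n}. (\<Sum>i=1..n. Poly_Mapping.lookup A (i, j, k)) = 1) \<and>
     (\<forall>i\<in>{1..n}. \<forall>k\<in>{1..n}. (\<Sum>j=1..n. Poly_Mapping.lookup A (i, j, k)) = 1) \<and>
     (\<forall>i\<in>{1..n}. \<forall>j\<in>{1..n}. (\<Sum>k=1..n. Poly_Mapping.lookup A (i, j, k)) = 1)}"

text \<open>
  The extensional function space fixes the values outside the \<open>n \<times> n\<close> index set, so that each
  Latin square is counted once.
\<close>

definition latin_squares :: "nat \<Rightarrow> (nat \<times> nat \<Rightarrow> nat) set" where
  "latin_squares n = {L \<in> ({1..n} \<times> {1..n}) \<rightarrow>\<^sub>E {1..n}.
     (\<forall>i\<in>{1..n}. \<forall>s\<in>{1..n}. \<exists>!j. j \<in> {1..n} \<and> L (i, j) = s) \<and>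
     (\<forall>j\<in>{1..n}. \<forall>s\<in>{1..n}. \<exists>!i. i \<in> {1..n} \<and> L (i, j) = s)}"

end

theory Submission
  imports Defs
begin

text \<open>
  Write \<open>n = 7 * M + r\<close> with \<open>r < 7\<close> and cut the cube of indices into \<open>7\<^sup>3\<close> cubes of side \<open>M\<close>
  and thin remainders. An outer design selects \<open>84\<close> cubes such that every line of cubes with distinct
  fixed coordinates meets exactly two of them. Put half a Latin square of order \<open>M\<close> into each
  selected cube, and fill up the diagonal cubes and the remainders by constants. On the selected
  cubes every line meets the support twice, so an array in the kernel of the line sums changes
  sign along a line. The graph of selected cubes is connected and contains a closed walk of length
  \<open>7\<close>; if the seven cubes on the walk carry the same Latin square, following the walk from an entry leads
  back to that entry, so the kernel is trivial there, and hence on all selected cubes. So any vertex of the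
  face of the array determines the other \<open>77\<close> Latin squares, which may be chosen freely. This
  gives at least \<open>L\<^sub>M\<^sup>7\<^sup>7\<close> vertices, and \<open>77 / 49 > 3 / 2\<close>.

  It remains to see that \<open>L\<^sub>M \<ge> M\<close> to the power \<open>(1 - o(1)) M\<^sup>2\<close>. A \<open>2d\<close>-regular bipartite
  graph has many \<open>d\<close>-regular halves: pair the edges at every vertex; any such system of
  pairings admits a \<open>2\<close>-colouring of the edges which separates all pairs, and double counting yields the bound.
  Halving repeatedly gives many factorizations of \<open>2\<^sup>a\<close>-regular graphs into perfect matchings.
\<close>

section \<open>Regular halves of bipartite graphs\<close>

text \<open>The pairs of \<open>\<sigma>\<close> and the pairs of \<open>\<tau>\<close> are two
  perfect matchings on \<open>E\<close>, so together they form disjoint cycles of even length, and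
  \<open>R\<close> takes every other vertex of each. The induction deletes one
  \<open>\<sigma>\<close>-pair and closes its cycle up again.\<close>

lemma common_transversal_of_involutions:
  assumes "finite E"
    and "\<And>e. e \<in> E \<Longrightarrow> \<sigma> e \<in> E \<and> \<sigma> e \<noteq> e \<and> \<sigma> (\<sigma> e) = e"
    and "\<And>e. e \<in> E \<Longrightarrow> \<tau> e \<in> E \<and> \<tau> e \<noteq> e \<and> \<tau> (\<tau> e) = e"
  shows "\<exists>R\<subseteq>E. \<forall>e\<in>E. (\<sigma> e \<in> R \<longleftrightarrow> e \<notin> R) \<and> (\<tau> e \<in> R \<longleftrightarrow> e \<notin> R)"
  using assms
proof (induction "card E" arbitrary: E \<tau> rule: less_induct)
  case less
  show ?case
  proof (cases "E = {}")
    case False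
    then obtain e where e: "e \<in> E" by blast
    define e' where "e' = \<sigma> e"
    define E' where "E' = E - {e, e'}"
    have se: "e' \<in> E" "e' \<noteq> e" "\<sigma> e' = e"
      using less.prems(2)[OF e] by (auto simp: e'_def)
    have sE': "\<sigma> x \<in> E' \<and> \<sigma> x \<noteq> x \<and> \<sigma> (\<sigma> x) = x" if "x \<in> E'" for x
      using less.prems(2)[of x] that se e'_def unfolding E'_def by (metis DiffD1 DiffD2 DiffI insert_iff singletonD)
    have small: "card E' < card E" "finite E'"
      using e less.prems(1) unfolding E'_def by (auto intro: psubset_card_mono)
    show ?thesis
    proof (cases "\<tau> e = e'")
      case True
      then have te': "\<tau> e' = e" using less.prems(3)[OF e] by auto
      have tE': "\<tau> x \<in> E' \<and> \<tau> x \<noteq> x \<and> \<tau> (\<tau> x) = x" if "x \<in> E'" for x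
        using less.prems(3)[of x] that se True te' unfolding E'_def by (metis DiffD1 DiffD2 DiffI insert_iff singletonD)
      from less.hyps[OF small(1) small(2) sE' tE'] obtain R where R: "R \<subseteq> E'"
        "\<forall>x\<in>E'. (\<sigma> x \<in> R \<longleftrightarrow> x \<notin> R) \<and> (\<tau> x \<in> R \<longleftrightarrow> x \<notin> R)" by blast
      show ?thesis
      proof (intro exI[of _ "insert e R"] conjI ballI)
        fix x assume x: "x \<in> E"
        have nR: "e' \<notin> R" "e \<notin> R" using R(1) E'_def by auto
        show "(\<sigma> x \<in> insert e R) = (x \<notin> insert e R)"
          using R(2) sE'[of x] nR se x by (cases "x \<in> E'") (auto simp: E'_def e'_def)
        show "(\<tau> x \<in> insert e R) = (x \<notin> insert e R)"
          using R(2) tE'[of x] nR se x True te' by (cases "x \<in> E'") (auto simp: E'_def)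
      qed (use R e E'_def in auto)
    next
      case False
      define f f' where "f = \<tau> e" and "f' = \<tau> e'"
      have ff: "f \<in> E'" "f' \<in> E'" "\<tau> f = e" "\<tau> f' = e'" "f \<noteq> f'"
        using less.prems(3)[OF e] less.prems(3)[OF se(1)] False se
        unfolding f_def f'_def E'_def by auto
      \<comment> \<open>The stretch \<open>f\<close>, \<open>e\<close>, \<open>e'\<close>,
        \<open>f'\<close> of a cycle is contracted to a single \<open>\<tau>'\<close>-pair.\<close>
      define \<tau>' where "\<tau>' = \<tau>(f := f', f' := f)"
      have tE': "\<tau>' x \<in> E' \<and> \<tau>' x \<noteq> x \<and> \<tau>' (\<tau>' x) = x" if x: "x \<in> E'" for x
      proof (cases "x = f \<or> x = f'")
        case True then show ?thesis using ff unfolding \<tau>'_def by auto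
      next
        case nx: False
        have 1: "x \<in> E" "x \<noteq> e" "x \<noteq> e'" using x unfolding E'_def by auto
        have 2: "\<tau> x \<in> E" "\<tau> x \<noteq> x" "\<tau> (\<tau> x) = x" using less.prems(3)[OF 1(1)] by auto
        have 3: "\<tau> x \<noteq> f" "\<tau> x \<noteq> f'" using 2(3) ff 1 by auto
        have 4: "\<tau> x \<noteq> e" "\<tau> x \<noteq> e'" using 2(3) nx f_def f'_def by auto
        show ?thesis using nx 1 2 3 4 unfolding \<tau>'_def E'_def by auto
      qed
      from less.hyps[OF small(1) small(2) sE' tE'] obtain R where R: "R \<subseteq> E'"
        "\<forall>x\<in>E'. (\<sigma> x \<in> R \<longleftrightarrow> x \<notin> R) \<and> (\<tau>' x \<in> R \<longleftrightarrow> x \<notin> R)" by blast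
      have nR: "e' \<notin> R" "e \<notin> R" using R(1) E'_def by auto
      have fR: "f' \<in> R \<longleftrightarrow> f \<notin> R" using R(2) ff unfolding \<tau>'_def by (metis fun_upd_apply)
      \<comment> \<open>Since \<open>R\<close> separates \<open>f\<close> from \<open>f'\<close>,
        exactly one of \<open>e\<close>, \<open>e'\<close> has its \<open>\<tau>\<close>-partner
        outside \<open>R\<close>; that one joins.\<close>
      define R' where "R' = insert (if f \<in> R then e' else e) R"
      show ?thesis
      proof (intro exI[of _ R'] conjI ballI)
        fix x assume x: "x \<in> E"
        show "(\<sigma> x \<in> R') = (x \<notin> R')"
          using R(2) sE'[of x] nR se x unfolding R'_def by (cases "x \<in> E'") (auto simp: E'_def e'_def)
        show "(\<tau> x \<in> R') = (x \<notin> R')"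
        proof (cases "x \<in> {e, e', f, f'}")
          case True
          then show ?thesis
            using nR fR ff se f_def f'_def R(1) unfolding R'_def E'_def by auto
        next
          case nx: False
          have 2: "\<tau> x \<in> E" "\<tau> x \<noteq> x" "\<tau> (\<tau> x) = x" using less.prems(3)[OF x] by auto
          have 4: "\<tau> x \<noteq> e" "\<tau> x \<noteq> e'" using 2(3) nx f_def f'_def by auto
          have "\<tau>' x \<in> R \<longleftrightarrow> x \<notin> R" using R(2) nx x unfolding E'_def by auto
          then show ?thesis using nx 4 unfolding R'_def \<tau>'_def by auto
        qed
      qed (use R e se E'_def R'_def in auto)
    qed
  qed auto
qed

abbreviation flip :: "nat \<Rightarrow> nat" where
  "flip s \<equiv> if even s then s + 1 else s - 1"

text \<open>Matches the consecutive members of each ordering \<open>f v\<close>. Every element of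
  \<open>E\<close> lies in exactly one class, so these matchings glue to one involution.\<close>

lemma pairing_involution:
  assumes P: "disjoint P" and cov: "E \<subseteq> \<Union>P"
    and f: "\<And>v. v \<in> P \<Longrightarrow> bij_betw (f v) {..<2 * d} (E \<inter> v)"
  obtains \<sigma> where "\<And>e. e \<in> E \<Longrightarrow> \<sigma> e \<in> E \<and> \<sigma> e \<noteq> e \<and> \<sigma> (\<sigma> e) = e"
    and "\<And>v s. v \<in> P \<Longrightarrow> s < 2 * d \<Longrightarrow> \<sigma> (f v s) = f v (flip s)"
proof -
  define star where "star e = (THE v. v \<in> P \<and> e \<in> v)" for e
  define \<sigma> where "\<sigma> e = f (star e) (flip (the_inv_into {..<2 * d} (f (star e)) e))" for e
  have star: "star e = v" if "v \<in> P" "e \<in> v" for e v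
    unfolding star_def using P that by (intro the_equality) (auto simp: disjoint_def)
  have fE: "f v s \<in> E" "f v s \<in> v" if "v \<in> P" "s < 2 * d" for v s
    using f[OF that(1)] that(2) by (auto simp: bij_betw_def)
  have flip: "flip s < 2 * d" "flip s \<noteq> s" "flip (flip s) = s" if "s < 2 * d" for s
    using that by (auto elim: oddE evenE)
  have \<sigma>: "\<sigma> (f v s) = f v (flip s)" if "v \<in> P" "s < 2 * d" for v s
    using star[OF that(1) fE(2)[OF that]] f[OF that(1)] that(2)
    by (simp add: \<sigma>_def bij_betw_def the_inv_into_f_f)
  have "\<sigma> e \<in> E \<and> \<sigma> e \<noteq> e \<and> \<sigma> (\<sigma> e) = e" if e: "e \<in> E" for e
  proof -
    obtain v where v: "v \<in> P" "e \<in> v" using cov e by blast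
    then have "e \<in> f v ` {..<2 * d}" using f[OF v(1)] e by (auto simp: bij_betw_def)
    then obtain s where s: "s < 2 * d" "e = f v s" by auto
    have "f v (flip s) \<noteq> f v s"
      using f[OF v(1)] flip[OF s(1)] s(1) by (metis bij_betw_def inj_on_eq_iff lessThan_iff)
    moreover have "\<sigma> e = f v (flip s)" "\<sigma> (\<sigma> e) = e"
      using \<sigma>[OF v(1) s(1)] \<sigma>[OF v(1) flip(1)[OF s(1)]] flip(3)[OF s(1)] s(2) by simp_all
    ultimately show ?thesis
      using fE(1)[OF v(1) flip(1)[OF s(1)]] s(2) by simp
  qed
  then show ?thesis using \<sigma> that by blast
qed

lemma card_injections:
  assumes "finite C" "card C = k"
  shows "card {f \<in> {..<k} \<rightarrow>\<^sub>E C. inj_on f {..<k}} = fact k"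
proof -
  have "card {f \<in> {..<k} \<rightarrow>\<^sub>E C. inj_on f {..<k}} = (\<Prod>i=0..<k. k - i)"
    using card_inj_on_subset_funcset[of "{..<k}" C "{..<k}"] assms by simp
  also have "\<dots> = fact k"
    by (simp add: fact_prod_rev)
  finally show ?thesis .
qed

text \<open>An ordering of \<open>X\<close> all of whose consecutive pairs are split by \<open>Y\<close> is determined by the induced
  orderings of \<open>Y\<close> and of \<open>X - Y\<close> together with one bit for each pair.\<close>

lemma card_split_orderings_le:
  assumes X: "finite X" and Y: "Y \<subseteq> X" "card Y = d" "card (X - Y) = d"
  shows "card {f \<in> {..<2 * d} \<rightarrow>\<^sub>E X. inj_on f {..<2 * d} \<and>
      (\<forall>t<d. f (2 * t) \<in> Y \<longleftrightarrow> f (2 * t + 1) \<notin> Y)} \<le> fact d * fact d * 2 ^ d"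
    (is "card ?S \<le> _")
proof -
  define y where "y f t = (if f (2 * t) \<in> Y then f (2 * t) else f (2 * t + 1))" for f :: "nat \<Rightarrow> 'a" and t
  define z where "z f t = (if f (2 * t) \<in> Y then f (2 * t + 1) else f (2 * t))" for f :: "nat \<Rightarrow> 'a" and t
  define \<Phi> where "\<Phi> f = (restrict (y f) {..<d}, restrict (z f) {..<d}, {t. t < d \<and> f (2 * t) \<in> Y})"
    for f :: "nat \<Rightarrow> 'a"
  define J where "J C = {g \<in> {..<d} \<rightarrow>\<^sub>E C. inj_on g {..<d}}" for C :: "'a set"
  have inj: "inj_on \<Phi> ?S"
  proof (rule inj_onI)
    fix f g assume f: "f \<in> ?S" and g: "g \<in> ?S" and eq: "\<Phi> f = \<Phi> g"
    have 1: "y f t = y g t" "z f t = z g t" "f (2 * t) \<in> Y \<longleftrightarrow> g (2 * t) \<in> Y" if "t < d" for t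
      using eq that unfolding \<Phi>_def prod.inject
      by (metis lessThan_iff restrict_apply', metis lessThan_iff restrict_apply', blast)
    have 2: "f (2 * t) = g (2 * t) \<and> f (2 * t + 1) = g (2 * t + 1)" if "t < d" for t
      using 1[OF that] unfolding y_def z_def by (auto split: if_splits)
    have "f \<in> {..<2 * d} \<rightarrow>\<^sub>E X" "g \<in> {..<2 * d} \<rightarrow>\<^sub>E X" using f g by auto
    then show "f = g"
    proof (rule PiE_ext)
      fix s assume "s \<in> {..<2 * d}"
      then show "f s = g s"
        using 2[of "s div 2"] by (cases "even s") (auto elim!: evenE oddE)
    qed
  qed
  have "\<Phi> ` ?S \<subseteq> J Y \<times> J (X - Y) \<times> Pow {..<d}"
  proof (rule image_subsetI)
    fix f assume f: "f \<in> ?S"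
    have in_X: "f s \<in> X" if "s < 2 * d" for s using f that by auto
    have inj: "s = t" if "s < d" "t < d" "p \<in> {2 * s, 2 * s + 1}" "q \<in> {2 * t, 2 * t + 1}" "f p = f q"
      for s t p q
    proof -
      have "p \<in> {..<2 * d}" "q \<in> {..<2 * d}" using that by auto
      then have "p = q" using f \<open>f p = f q\<close> by (auto dest: inj_onD)
      then show ?thesis using that by auto
    qed
    have spl: "f (2 * t) \<in> Y \<longleftrightarrow> f (2 * t + 1) \<notin> Y" if "t < d" for t
      using f that by auto
    have "y f t \<in> Y" "z f t \<in> X - Y" if "t < d" for t
      using spl[OF that] in_X[of "2 * t"] in_X[of "2 * t + 1"] that by (auto simp: y_def z_def)
    moreover have "\<exists>p\<in>{2 * t, 2 * t + 1}. y f t = f p" "\<exists>p\<in>{2 * t, 2 * t + 1}. z f t = f p" for t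
      by (auto simp: y_def z_def)
    then have "inj_on (y f) {..<d}" "inj_on (z f) {..<d}"
      unfolding inj_on_def using inj by (metis lessThan_iff)+
    ultimately show "\<Phi> f \<in> J Y \<times> J (X - Y) \<times> Pow {..<d}"
      unfolding \<Phi>_def J_def by (auto simp: inj_on_def)
  qed
  moreover have fin: "finite (J Y)" "finite (J (X - Y))"
    unfolding J_def using finite_subset[OF Y(1) X] X by (simp_all add: finite_PiE)
  ultimately have "card ?S \<le> card (J Y \<times> J (X - Y) \<times> Pow {..<d})"
    using inj by (intro card_inj_on_le) auto
  also have "\<dots> = fact d * fact d * 2 ^ d"
    using X Y finite_subset[OF Y(1) X] by (simp add: J_def card_injections card_cartesian_product card_Pow)
  finally show ?thesis .
qed

text \<open>A bipartite multigraph: its edges are the elements of \<open>\<Union>P\<close>, each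
  vertex is given by the star of edges at it, and \<open>P\<close> and \<open>Q\<close> are the two
  sides. By disjointness and \<open>cover\<close> every edge has one end on each side.\<close>

locale two_partitions =
  fixes P Q :: "'e set set"
  assumes finite_stars: "finite P" "finite Q"
    and disjoint_stars: "disjoint P" "disjoint Q"
    and cover: "\<Union>Q = \<Union>P"
    and finite_edges: "finite (\<Union>P)"
begin

definition regular :: "nat \<Rightarrow> 'e set \<Rightarrow> bool" where
  "regular k E \<longleftrightarrow> E \<subseteq> \<Union>P \<and> (\<forall>v\<in>P \<union> Q. card (E \<inter> v) = k)"

text \<open>Proper edge colourings. If \<open>E\<close> is \<open>k\<close>-regular, each of the
  \<open>k\<close> colour classes is a perfect matching, so these are the factorizations with
  ordered factors.\<close>

definition factorizations :: "nat \<Rightarrow> 'e set \<Rightarrow> ('e \<Rightarrow> nat) set" where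
  "factorizations k E = {c \<in> E \<rightarrow>\<^sub>E {..<k}. \<forall>v\<in>P \<union> Q. inj_on c (E \<inter> v)}"

lemma finite_regular: "regular k E \<Longrightarrow> finite E"
  using finite_edges finite_subset by (auto simp: regular_def)

lemma finite_factorizations: "finite E \<Longrightarrow> finite (factorizations k E)"
  by (rule finite_subset[of _ "E \<rightarrow>\<^sub>E {..<k}"]) (auto simp: factorizations_def finite_PiE)

lemma regular_diff:
  assumes "regular (2 * d) E" "regular d R" "R \<subseteq> E"
  shows "regular d (E - R)"
proof -
  have "card ((E - R) \<inter> v) = d" if "v \<in> P \<union> Q" for v
  proof -
    have "(E - R) \<inter> v = E \<inter> v - R \<inter> v" by auto
    moreover have "finite (R \<inter> v)" using finite_regular[OF assms(2)] by simp
    moreover have "R \<inter> v \<subseteq> E \<inter> v" using assms(3) by auto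
    ultimately show ?thesis
      using assms that by (simp add: card_Diff_subset regular_def)
  qed
  then show ?thesis using assms by (auto simp: regular_def)
qed

text \<open>Pairing consecutive edges gives one involution for the stars of \<open>P\<close> and one
  for those of \<open>Q\<close>; a common transversal of the two splits all pairs.\<close>

lemma balanced_split_exists:
  assumes E: "regular (2 * d) E"
    and f: "\<And>v. v \<in> P \<union> Q \<Longrightarrow> bij_betw (f v) {..<2 * d} (E \<inter> v)"
  obtains R where "R \<subseteq> E" "\<And>v t. v \<in> P \<union> Q \<Longrightarrow> t < d \<Longrightarrow> f v (2 * t) \<in> R \<longleftrightarrow> f v (2 * t + 1) \<notin> R"
proof -
  have cov: "E \<subseteq> \<Union>P" "E \<subseteq> \<Union>Q" using E cover by (auto simp: regular_def)
  obtain \<sigma> where \<sigma>: "\<And>e. e \<in> E \<Longrightarrow> \<sigma> e \<in> E \<and> \<sigma> e \<noteq> e \<and> \<sigma> (\<sigma> e) = e"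
    "\<And>v s. v \<in> P \<Longrightarrow> s < 2 * d \<Longrightarrow> \<sigma> (f v s) = f v (flip s)"
    using pairing_involution[OF disjoint_stars(1) cov(1), of f d] f by auto
  obtain \<tau> where \<tau>: "\<And>e. e \<in> E \<Longrightarrow> \<tau> e \<in> E \<and> \<tau> e \<noteq> e \<and> \<tau> (\<tau> e) = e"
    "\<And>v s. v \<in> Q \<Longrightarrow> s < 2 * d \<Longrightarrow> \<tau> (f v s) = f v (flip s)"
    using pairing_involution[OF disjoint_stars(2) cov(2), of f d] f by auto
  obtain R where R: "R \<subseteq> E" "\<forall>e\<in>E. (\<sigma> e \<in> R \<longleftrightarrow> e \<notin> R) \<and> (\<tau> e \<in> R \<longleftrightarrow> e \<notin> R)"
    using common_transversal_of_involutions[OF finite_regular[OF E] \<sigma>(1) \<tau>(1)] by blast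
  have "f v (2 * t) \<in> R \<longleftrightarrow> f v (2 * t + 1) \<notin> R" if "v \<in> P \<union> Q" "t < d" for v t
  proof -
    have "f v (2 * t) \<in> E" using f[OF that(1)] that(2) by (auto simp: bij_betw_def)
    moreover have "\<sigma> (f v (2 * t)) = f v (2 * t + 1) \<or> \<tau> (f v (2 * t)) = f v (2 * t + 1)"
      using that \<sigma>(2)[of v "2 * t"] \<tau>(2)[of v "2 * t"] by auto
    ultimately show ?thesis using R(2) by metis
  qed
  then show ?thesis using R(1) that by blast
qed

text \<open>Count the pairs of a balanced \<open>R\<close> and a system of orderings of the stars whose consecutive
  pairs are split by \<open>R\<close>: every system of orderings occurs.\<close>

lemma many_regular_halves:
  assumes E: "regular (2 * d) E"
  shows "fact (2 * d) ^ card (P \<union> Q)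
    \<le> card {R. R \<subseteq> E \<and> regular d R} * (fact d * fact d * 2 ^ d) ^ card (P \<union> Q)"
proof -
  define S where "S = P \<union> Q"
  define O1 where "O1 v = {f \<in> {..<2 * d} \<rightarrow>\<^sub>E (E \<inter> v). inj_on f {..<2 * d}}" for v
  define O2 where "O2 R v = {f \<in> {..<2 * d} \<rightarrow>\<^sub>E (E \<inter> v). inj_on f {..<2 * d} \<and>
    (\<forall>t<d. f (2 * t) \<in> R \<inter> v \<longleftrightarrow> f (2 * t + 1) \<notin> R \<inter> v)}" for R v
  define H where "H = {R. R \<subseteq> E \<and> regular d R}"
  have finS: "finite S" using finite_stars by (simp add: S_def)
  have finE: "finite E" using finite_regular[OF E] .
  have card_Ev: "card (E \<inter> v) = 2 * d" if "v \<in> S" for v using E that by (auto simp: regular_def S_def)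
  have finH: "finite H" unfolding H_def using finE by simp
  have "PiE S O1 \<subseteq> (\<Union>R\<in>H. PiE S (O2 R))"
  proof
    fix f assume f: "f \<in> PiE S O1"
    have bij: "bij_betw (f v) {..<2 * d} (E \<inter> v)" if "v \<in> S" for v
    proof -
      have "f v \<in> O1 v" using f that by auto
      then have 1: "inj_on (f v) {..<2 * d}" "f v ` {..<2 * d} \<subseteq> E \<inter> v" by (auto simp: O1_def)
      moreover have "f v ` {..<2 * d} = E \<inter> v"
        using 1 finE card_Ev[OF that] by (intro card_subset_eq) (auto simp: card_image)
      ultimately show ?thesis by (simp add: bij_betw_def)
    qed
    from balanced_split_exists[OF E, of f] bij
    obtain R where R: "R \<subseteq> E" "\<And>v t. v \<in> S \<Longrightarrow> t < d \<Longrightarrow> f v (2 * t) \<in> R \<longleftrightarrow> f v (2 * t + 1) \<notin> R"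
      unfolding S_def by blast
    have inv: "f v s \<in> v" if "v \<in> S" "s < 2 * d" for v s
      using bij[OF that(1)] that(2) by (auto simp: bij_betw_def)
    have "card (R \<inter> v) = d" if v: "v \<in> S" for v
    proof -
      \<comment> \<open>Picking from each pair its member in \<open>R\<close> enumerates
        \<open>R \<inter> v\<close> without repetition.\<close>
      define g where "g t = (if f v (2 * t) \<in> R then f v (2 * t) else f v (2 * t + 1))" for t
      have ex: "\<exists>p\<in>{2 * t, 2 * t + 1}. g t = f v p" for t by (auto simp: g_def)
      have "inj_on g {..<d}"
      proof (rule inj_onI)
        fix s t assume st: "s \<in> {..<d}" "t \<in> {..<d}" "g s = g t"
        obtain p q where pq: "p \<in> {2 * s, 2 * s + 1}" "q \<in> {2 * t, 2 * t + 1}" "f v p = f v q"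
          using ex[of s] ex[of t] st(3) by metis
        have "p \<in> {..<2 * d}" "q \<in> {..<2 * d}" using pq st by auto
        then have "p = q" using pq(3) bij[OF v] by (auto simp: bij_betw_def dest: inj_onD)
        then show "s = t" using pq by auto
      qed
      moreover have "g ` {..<d} = R \<inter> v"
      proof
        show "g ` {..<d} \<subseteq> R \<inter> v" using R(2)[OF v] inv[OF v] by (auto simp: g_def)
        show "R \<inter> v \<subseteq> g ` {..<d}"
        proof
          fix e assume e: "e \<in> R \<inter> v"
          then have "e \<in> f v ` {..<2 * d}" using R(1) bij[OF v] by (auto simp: bij_betw_def)
          then obtain s where s: "s < 2 * d" "e = f v s" by auto
          then have "s div 2 < d" by auto
          moreover have "g (s div 2) = e"
            using R(2)[OF v, of "s div 2"] s e by (cases "even s") (auto simp: g_def elim!: evenE oddE)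
          ultimately show "e \<in> g ` {..<d}" by blast
        qed
      qed
      ultimately show ?thesis by (metis card_image card_lessThan)
    qed
    then have "R \<in> H" using R(1) E by (auto simp: H_def regular_def S_def)
    moreover have "f \<in> PiE S (O2 R)"
    proof (rule PiE_I)
      fix v assume v: "v \<in> S"
      then have "f v \<in> O1 v" using f by auto
      then show "f v \<in> O2 R v" using R(2)[OF v] inv[OF v] by (auto simp: O1_def O2_def)
    qed (use f in auto)
    ultimately show "f \<in> (\<Union>R\<in>H. PiE S (O2 R))" by blast
  qed
  moreover have "finite (O2 R v)" for R v
    unfolding O2_def using finE by (simp add: finite_PiE)
  ultimately have "card (PiE S O1) \<le> card (\<Union>R\<in>H. PiE S (O2 R))"
    using finH finS by (intro card_mono) (auto intro!: finite_PiE)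
  also have "\<dots> \<le> (\<Sum>R\<in>H. card (PiE S (O2 R)))"
    using finH by (rule card_UN_le)
  also have "\<dots> \<le> (\<Sum>R\<in>H. (fact d * fact d * 2 ^ d) ^ card S)"
  proof (rule sum_mono)
    fix R assume R: "R \<in> H"
    have "card (O2 R v) \<le> fact d * fact d * 2 ^ d" if v: "v \<in> S" for v
    proof -
      have 1: "card (R \<inter> v) = d" "R \<inter> v \<subseteq> E \<inter> v" using R v by (auto simp: H_def regular_def S_def)
      have "card (E \<inter> v - R \<inter> v) = d"
        using 1 card_Ev[OF v] finE by (subst card_Diff_subset) (auto intro: finite_subset)
      then show ?thesis
        unfolding O2_def using 1 finE by (intro card_split_orderings_le) auto
    qed
    then show "card (PiE S (O2 R)) \<le> (fact d * fact d * 2 ^ d) ^ card S"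
      using finS by (simp add: card_PiE prod_le_power)
  qed
  also have "\<dots> = card H * (fact d * fact d * 2 ^ d) ^ card S" by simp
  finally have "card (PiE S O1) \<le> \<dots>" .
  moreover have "card (PiE S O1) = fact (2 * d) ^ card S"
    using finS finE card_Ev by (simp add: card_PiE O1_def card_injections)
  ultimately show ?thesis by (simp add: H_def S_def)
qed

text \<open>Each star contributes the factor
  \<open>fact (2 * d) / (fact d * fact d * 2 ^ d)\<close>, which is the central binomial coefficient
  over \<open>2 ^ d\<close>, and that coefficient is at least
  \<open>4 ^ d / (2 * d)\<close>.\<close>

lemma card_regular_halves_ge:
  assumes E: "regular (2 * d) E" and d: "0 < d"
  shows "2 ^ (d * card (P \<union> Q)) \<le> card {R. R \<subseteq> E \<and> regular d R} * (2 * d) ^ card (P \<union> Q)"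
proof -
  define s where "s = card (P \<union> Q)"
  define h where "h = card {R. R \<subseteq> E \<and> regular d R}"
  define F where "F = (fact d * fact d :: nat)"
  have F: "F > 0" by (simp add: F_def)
  have "real (4 ^ d) \<le> real (2 * d * ((2 * d) choose d))"
    using central_binomial_lower_bound[OF d] d by (simp add: field_simps)
  then have "4 ^ d \<le> 2 * d * ((2 * d) choose d)" by (simp only: of_nat_le_iff)
  then have "(4 ^ d * F) \<le> 2 * d * (F * ((2 * d) choose d))" by (simp add: mult.assoc mult.left_commute)
  also have "F * ((2 * d) choose d) = fact (2 * d)"
    using binomial_fact_lemma[of d "2 * d"] by (simp add: F_def)
  finally have "(4 ^ d * F) ^ s \<le> (2 * d * fact (2 * d)) ^ s" by (rule power_mono) simp
  also have "\<dots> = (2 * d) ^ s * fact (2 * d) ^ s" by (rule power_mult_distrib)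
  also have "\<dots> \<le> (2 * d) ^ s * (h * (F * 2 ^ d) ^ s)"
    using many_regular_halves[OF E] unfolding h_def s_def F_def by (rule mult_left_mono) simp
  also have "\<dots> = (h * (2 * d) ^ s) * (2 ^ (d * s) * F ^ s)"
    by (simp only: power_mult_distrib[of F] power_mult mult_ac)
  also have "(4 ^ d * F) ^ s = 2 ^ (d * s) * (2 ^ (d * s) * F ^ s)"
  proof -
    have "(4 :: nat) ^ d = 2 ^ d * 2 ^ d" by (simp flip: power_mult_distrib)
    then show ?thesis by (simp only: power_mult_distrib power_mult mult.assoc)
  qed
  finally have "2 ^ (d * s) * (2 ^ (d * s) * F ^ s) \<le> (h * (2 * d) ^ s) * (2 ^ (d * s) * F ^ s)" .
  then show ?thesis unfolding h_def s_def using F by simp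
qed

end

section \<open>Counting factorizations and Latin squares\<close>

context two_partitions
begin

text \<open>Shifting the colours on \<open>E2\<close> by \<open>k1\<close> keeps the two palettes
  apart. The filter on the right recovers \<open>E1\<close> from the small colours, so gluings along
  different splittings are disjoint.\<close>

lemma card_factorizations_glue:
  assumes disj: "E1 \<inter> E2 = {}" and fin: "finite E1" "finite E2"
  shows "card (factorizations k1 E1) * card (factorizations k2 E2)
    \<le> card {c \<in> factorizations (k1 + k2) (E1 \<union> E2). {e \<in> E1 \<union> E2. c e < k1} = E1}"
proof -
  define g where "g p e = (if e \<in> E1 then fst p e else if e \<in> E2 then k1 + snd p e else undefined)"
    for p :: "('e \<Rightarrow> nat) \<times> ('e \<Rightarrow> nat)" and e
  define F where "F = factorizations k1 E1 \<times> factorizations k2 E2"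
  have "inj_on g F"
  proof (rule inj_onI)
    fix p q assume p: "p \<in> F" and q: "q \<in> F" and eq: "g p = g q"
    have mem: "fst p \<in> E1 \<rightarrow>\<^sub>E {..<k1}" "fst q \<in> E1 \<rightarrow>\<^sub>E {..<k1}"
      "snd p \<in> E2 \<rightarrow>\<^sub>E {..<k2}" "snd q \<in> E2 \<rightarrow>\<^sub>E {..<k2}"
      using p q by (auto simp: F_def factorizations_def)
    have "fst p e = fst q e" if "e \<in> E1" for e
      using fun_cong[OF eq, of e] that by (simp add: g_def)
    moreover have "snd p e = snd q e" if "e \<in> E2" for e
    proof -
      have "e \<notin> E1" using that disj by auto
      then show ?thesis using fun_cong[OF eq, of e] that by (simp add: g_def)
    qed
    ultimately have "fst p = fst q" "snd p = snd q"
      using PiE_ext[OF mem(1,2)] PiE_ext[OF mem(3,4)] by simp_all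
    then show "p = q" by (simp add: prod_eq_iff)
  qed
  moreover have "g ` F \<subseteq> {c \<in> factorizations (k1 + k2) (E1 \<union> E2). {e \<in> E1 \<union> E2. c e < k1} = E1}"
  proof (rule image_subsetI)
    fix p assume p: "p \<in> F"
    have r1: "fst p e < k1" if "e \<in> E1" for e using p that by (auto simp: F_def factorizations_def)
    have r2: "snd p e < k2" if "e \<in> E2" for e using p that by (auto simp: F_def factorizations_def)
    have i1: "e = e'" if "v \<in> P \<union> Q" "e \<in> E1 \<inter> v" "e' \<in> E1 \<inter> v" "fst p e = fst p e'" for e e' v
    proof (rule inj_onD[OF _ that(4,2,3)])
      show "inj_on (fst p) (E1 \<inter> v)" using p that(1) by (auto simp: F_def factorizations_def)
    qed
    have i2: "e = e'" if "v \<in> P \<union> Q" "e \<in> E2 \<inter> v" "e' \<in> E2 \<inter> v" "snd p e = snd p e'" for e e' v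
    proof (rule inj_onD[OF _ that(4,2,3)])
      show "inj_on (snd p) (E2 \<inter> v)" using p that(1) by (auto simp: F_def factorizations_def)
    qed
    have g1: "g p e = fst p e" if "e \<in> E1" for e using that by (simp add: g_def)
    have g2: "g p e = k1 + snd p e" if "e \<in> E2" for e using that disj by (auto simp: g_def)
    have "g p \<in> (E1 \<union> E2) \<rightarrow>\<^sub>E {..<k1 + k2}"
      using r1 r2 g1 g2 by (intro PiE_I) (auto simp: g_def trans_less_add1)
    moreover have "inj_on (g p) ((E1 \<union> E2) \<inter> v)" if v: "v \<in> P \<union> Q" for v
    proof (rule inj_onI)
      fix e e' assume e: "e \<in> (E1 \<union> E2) \<inter> v" "e' \<in> (E1 \<union> E2) \<inter> v" "g p e = g p e'"
      then consider "e \<in> E1" "e' \<in> E1" | "e \<in> E1" "e' \<in> E2" | "e \<in> E2" "e' \<in> E1" | "e \<in> E2" "e' \<in> E2"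
        by blast
      then show "e = e'"
      proof cases
        case 1 then show ?thesis using i1[OF v] e g1 by auto
      next
        case 2 then show ?thesis using r1[of e] e g1 g2 by auto
      next
        case 3 then show ?thesis using r1[of e'] e g1[of e'] g2[of e] by auto
      next
        case 4 then show ?thesis using i2[OF v] e g2 by auto
      qed
    qed
    moreover have "{e \<in> E1 \<union> E2. g p e < k1} = E1" using r1 g1 g2 by auto
    ultimately show "g p \<in> {c \<in> factorizations (k1 + k2) (E1 \<union> E2). {e \<in> E1 \<union> E2. c e < k1} = E1}"
      by (simp add: factorizations_def)
  qed
  moreover have "finite (factorizations (k1 + k2) (E1 \<union> E2))"
    using fin by (simp add: finite_factorizations)
  ultimately have "card F \<le> card {c \<in> factorizations (k1 + k2) (E1 \<union> E2). {e \<in> E1 \<union> E2. c e < k1} = E1}"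
    by (intro card_inj_on_le) auto
  then show ?thesis by (simp add: F_def card_cartesian_product)
qed

lemma card_factorizations_union_ge:
  assumes "E1 \<inter> E2 = {}" "finite E1" "finite E2"
  shows "card (factorizations k1 E1) * card (factorizations k2 E2)
    \<le> card (factorizations (k1 + k2) (E1 \<union> E2))"
  using card_factorizations_glue[OF assms, of k1 k2]
  by (rule order_trans) (use assms in \<open>auto intro!: card_mono finite_factorizations\<close>)

text \<open>Nothing is counted twice, because the half \<open>R\<close> is the set of edges with a
  colour below \<open>d\<close>.\<close>

lemma card_factorizations_double_ge:
  assumes E: "regular (2 * d) E"
  shows "(\<Sum>R | R \<subseteq> E \<and> regular d R. card (factorizations d R) * card (factorizations d (E - R)))
    \<le> card (factorizations (2 * d) E)"
proof -
  define H where "H = {R. R \<subseteq> E \<and> regular d R}"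
  define C where "C R = {c \<in> factorizations (2 * d) E. {e \<in> E. c e < d} = R}" for R
  have fin: "finite E" using finite_regular[OF E] .
  then have finH: "finite H" by (simp add: H_def)
  have "card (factorizations d R) * card (factorizations d (E - R)) \<le> card (C R)" if "R \<in> H" for R
  proof -
    have "R \<subseteq> E" using that by (simp add: H_def)
    moreover from this have "R \<union> (E - R) = E" by auto
    ultimately show ?thesis
      using card_factorizations_glue[of R "E - R" d d] fin finite_subset[of R E]
      by (simp add: C_def mult_2)
  qed
  then have "(\<Sum>R\<in>H. card (factorizations d R) * card (factorizations d (E - R))) \<le> (\<Sum>R\<in>H. card (C R))"
    by (rule sum_mono)
  also have "\<dots> = card (\<Union>R\<in>H. C R)"
    using finH finite_factorizations[OF fin]
    by (intro card_UN_disjoint[symmetric]) (auto simp: C_def)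
  also have "\<dots> \<le> card (factorizations (2 * d) E)"
    by (rule card_mono) (auto simp: C_def finite_factorizations[OF fin])
  finally show ?thesis by (simp add: H_def)
qed

text \<open>With \<open>d = 2 ^ a\<close> and \<open>s\<close> stars, the exponent \<open>g a = s * (d * (a - 4) / 2 + a + 2)\<close> solves the
  recursion \<open>g (a + 1) = 2 * g a + s * (d - a - 1)\<close> obtained from halving. The bound \<open>2 ^ g a\<close> is stated
  squared, with all subtractions cleared.\<close>

lemma card_factorizations_pow2_ge:
  assumes "regular (2 ^ a) E"
  shows "2 ^ (card (P \<union> Q) * (a * 2 ^ a + 2 * a + 4))
    \<le> (card (factorizations (2 ^ a) E))\<^sup>2 * 2 ^ (card (P \<union> Q) * (4 * 2 ^ a))"
  using assms
proof (induction a arbitrary: E)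
  case 0
  \<comment> \<open>For \<open>a = 0\<close> both powers of two coincide, so a single factorization
    suffices.\<close>
  have "(\<lambda>e\<in>E. 0) \<in> factorizations 1 E"
  proof -
    have "inj_on (\<lambda>e\<in>E. 0::nat) (E \<inter> v)" if "v \<in> P \<union> Q" for v
    proof -
      have "card (E \<inter> v) = 1" using 0 that by (auto simp: regular_def)
      then show ?thesis by (auto simp: card_1_singleton_iff)
    qed
    then show ?thesis by (auto simp: factorizations_def)
  qed
  then have "card (factorizations 1 E) \<ge> 1"
    using finite_factorizations[OF finite_regular[OF 0]] by (auto simp: Suc_le_eq card_gt_0_iff)
  then show ?case by simp
next
  case (Suc a)
  define s d B K where "s = card (P \<union> Q)" and "d = (2 :: nat) ^ a"
    and "B = (2 :: nat) ^ (s * (a * d + 2 * a + 4))" and "K = (2 :: nat) ^ (s * (4 * d))"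
  define x where "x R = card (factorizations d R)" for R
  define H where "H = {R. R \<subseteq> E \<and> regular d R}"
  define y where "y = card (factorizations (2 * d) E)"
  have E: "regular (2 * d) E" using Suc.prems by (simp add: d_def)
  have IH: "B \<le> (x R)\<^sup>2 * K" if "regular d R" for R
    using Suc.IH[of R] that by (simp add: B_def x_def K_def s_def d_def)
  \<comment> \<open>The product of the squared bounds for the two halves is a bound between squares,
    so the root can be taken within the naturals.\<close>
  have "B \<le> x R * x (E - R) * K" if "R \<in> H" for R
  proof -
    have "B * B \<le> ((x R)\<^sup>2 * K) * ((x (E - R))\<^sup>2 * K)"
      using IH[of R] IH[OF regular_diff[OF E]] that by (intro mult_mono) (auto simp: H_def)
    then have "B\<^sup>2 \<le> (x R * x (E - R) * K)\<^sup>2" by (simp add: power2_eq_square mult_ac)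
    then show ?thesis by (rule power2_le_imp_le) simp
  qed
  then have "(\<Sum>R\<in>H. B) \<le> (\<Sum>R\<in>H. x R * x (E - R) * K)" by (rule sum_mono)
  also have "\<dots> = (\<Sum>R\<in>H. x R * x (E - R)) * K" by (simp add: sum_distrib_right)
  also have "\<dots> \<le> y * K"
    using card_factorizations_double_ge[OF E] by (simp add: x_def H_def y_def)
  finally have 1: "card H * B \<le> y * K" by simp
  have "2 ^ (d * s) * B \<le> (card H * (2 * d) ^ s) * B"
    using card_regular_halves_ge[OF E] by (intro mult_right_mono) (auto simp: H_def d_def s_def)
  also have "\<dots> \<le> (y * K) * (2 * d) ^ s"
    using mult_right_mono[OF 1, of "(2 * d) ^ s"] by (simp add: mult_ac)
  also have "(2 * d) ^ s = 2 ^ ((a + 1) * s)" by (simp only: d_def power_Suc[symmetric] power_mult Suc_eq_plus1)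
  finally have "(2 ^ (d * s) * B)\<^sup>2 \<le> (y * K * 2 ^ ((a + 1) * s))\<^sup>2" by (rule power_mono) simp
  also have "(2 ^ (d * s) * B)\<^sup>2 = 2 ^ (2 * (d * s) + 2 * (s * (a * d + 2 * a + 4)))"
    by (simp add: B_def power_mult_distrib power_add power_mult[symmetric] mult.commute)
  \<comment> \<open>The recursion for the exponent; its last summand cancels against the square of
    \<open>(2 * d) ^ s\<close>.\<close>
  also have "2 * (d * s) + 2 * (s * (a * d + 2 * a + 4)) = s * (Suc a * (2 * d) + 2 * Suc a + 4) + 2 * ((a + 1) * s)"
    by (simp add: algebra_simps)
  also have "(y * K * 2 ^ ((a + 1) * s))\<^sup>2 = (y\<^sup>2 * 2 ^ (s * (4 * (2 * d)))) * 2 ^ (2 * ((a + 1) * s))"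
    by (simp add: K_def power_mult_distrib power_mult[symmetric] mult_ac)
  finally have "2 ^ (s * (Suc a * (2 * d) + 2 * Suc a + 4)) \<le> y\<^sup>2 * 2 ^ (s * (4 * (2 * d)))"
    by (simp add: power_add)
  then show ?case by (simp add: s_def d_def y_def)
qed

end

section \<open>Latin squares as factorizations of complete bipartite graphs\<close>

definition row_stars :: "nat \<Rightarrow> (nat \<times> nat) set set" where
  "row_stars M = (\<lambda>i. {i} \<times> {1..M}) ` {1..M}"

definition col_stars :: "nat \<Rightarrow> (nat \<times> nat) set set" where
  "col_stars M = (\<lambda>j. {1..M} \<times> {j}) ` {1..M}"

text \<open>A band of cyclic diagonals. Each diagonal is a permutation matrix, so for
  \<open>t \<le> M\<close> the band is regular of degree \<open>t - s\<close>, and consecutive bands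
  fill up the grid.\<close>

definition diags :: "nat \<Rightarrow> nat \<Rightarrow> nat \<Rightarrow> (nat \<times> nat) set" where
  "diags M s t = {(i, j) \<in> {1..M} \<times> {1..M}. s \<le> (i + j) mod M \<and> (i + j) mod M < t}"

text \<open>The complete bipartite graph on rows and columns, with the cells as edges.\<close>

interpretation grid: two_partitions "row_stars M" "col_stars M" for M
  by unfold_locales (auto simp: row_stars_def col_stars_def disjoint_def)

text \<open>For \<open>M = 1\<close> the only row and the only column are the same set of cells, so
  the count needs \<open>2 \<le> M\<close>.\<close>

lemma card_grid_stars: "2 \<le> M \<Longrightarrow> card (row_stars M \<union> col_stars M) = 2 * M"
proof -
  assume M: "2 \<le> M"
  have "row_stars M \<inter> col_stars M = {}"
  proof -
    have "{i} \<times> {1..M} \<noteq> {1..M} \<times> {j}" for i j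
    proof
      assume "{i} \<times> {1..M} = {1..M} \<times> {j}"
      moreover have "(i, 1) \<in> {i} \<times> {1..M}" "(i, 2) \<in> {i} \<times> {1..M}" using M by auto
      ultimately have "(i, 1) \<in> {1..M} \<times> {j}" "(i, 2) \<in> {1..M} \<times> {j}" by blast+
      then show False by simp
    qed
    then show ?thesis by (auto simp: row_stars_def col_stars_def)
  qed
  moreover have "card (row_stars M) = M" unfolding row_stars_def
    using M by (subst card_image) (auto simp: inj_on_def)
  moreover have "card (col_stars M) = M" unfolding col_stars_def
    using M by (subst card_image) (auto simp: inj_on_def)
  ultimately show ?thesis
    using grid.finite_stars by (simp add: card_Un_disjoint)
qed

lemma bij_betw_shift_mod:
  fixes M :: nat
  assumes "0 < M"
  shows "bij_betw (\<lambda>j. (i + j) mod M) {1..M} {..<M}"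
proof -
  have ne: "(i + j) mod M \<noteq> (i + k) mod M" if jk: "j \<in> {1..M}" "k \<in> {1..M}" "j < k" for j k
  proof
    assume "(i + j) mod M = (i + k) mod M"
    then have "M dvd (i + k) - (i + j)"
      using jk by (metis mod_eq_dvd_iff_nat add_le_mono le_refl less_imp_le)
    then show False using jk by (auto dest!: dvd_imp_le)
  qed
  have "inj_on (\<lambda>j. (i + j) mod M) {1..M}"
    by (rule inj_onI) (metis ne linorder_neqE_nat)
  moreover have "(\<lambda>j. (i + j) mod M) ` {1..M} \<subseteq> {..<M}" using assms by auto
  ultimately show ?thesis
    unfolding bij_betw_def using card_subset_eq[of "{..<M}" "(\<lambda>j. (i + j) mod M) ` {1..M}"]
    by (simp add: card_image)
qed

lemma regular_diags:
  assumes "s \<le> t" "t \<le> M"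
  shows "grid.regular M (t - s) (diags M s t)"
proof (cases "M = 0")
  case True
  then show ?thesis unfolding grid.regular_def by (auto simp: diags_def row_stars_def col_stars_def)
next
  case False
  have *: "card {j \<in> {1..M}. s \<le> (i + j) mod M \<and> (i + j) mod M < t} = t - s" for i
  proof -
    have "bij_betw (\<lambda>j. (i + j) mod M) {j \<in> {1..M}. (i + j) mod M \<in> {s..<t}} {s..<t}"
    proof -
      have "(\<lambda>j. (i + j) mod M) ` {j \<in> {1..M}. (i + j) mod M \<in> {s..<t}} = {s..<t}"
      proof
        show "{s..<t} \<subseteq> (\<lambda>j. (i + j) mod M) ` {j \<in> {1..M}. (i + j) mod M \<in> {s..<t}}"
        proof
          fix x assume x: "x \<in> {s..<t}"
          then have "x \<in> (\<lambda>j. (i + j) mod M) ` {1..M}"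
            using bij_betw_shift_mod[of M i] False assms by (simp add: bij_betw_def)
          then show "x \<in> (\<lambda>j. (i + j) mod M) ` {j \<in> {1..M}. (i + j) mod M \<in> {s..<t}}"
            using x by auto
        qed
      qed auto
      then show ?thesis
        using bij_betw_shift_mod[of M i] False
        by (auto simp: bij_betw_def intro: inj_on_subset)
    qed
    then show ?thesis by (auto dest: bij_betw_same_card)
  qed
  have r: "card (diags M s t \<inter> ({i} \<times> {1..M})) = t - s" if "i \<in> {1..M}" for i
  proof -
    have "diags M s t \<inter> ({i} \<times> {1..M}) = Pair i ` {j \<in> {1..M}. s \<le> (i + j) mod M \<and> (i + j) mod M < t}"
      using that by (auto simp: diags_def)
    then show ?thesis using * by (simp add: card_image inj_on_def)
  qed
  have c: "card (diags M s t \<inter> ({1..M} \<times> {i})) = t - s" if "i \<in> {1..M}" for i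
  proof -
    have "diags M s t \<inter> ({1..M} \<times> {i}) = (\<lambda>j. (j, i)) ` {j \<in> {1..M}. s \<le> (i + j) mod M \<and> (i + j) mod M < t}"
      using that by (auto simp: diags_def add.commute)
    then show ?thesis using * by (simp add: card_image inj_on_def)
  qed
  show ?thesis
    unfolding grid.regular_def using r c by (auto simp: row_stars_def col_stars_def diags_def)
qed

text \<open>Colouring each cell by its cyclic diagonal is proper; subtracting \<open>s\<close> makes
  the colours start at \<open>0\<close>.\<close>

lemma card_factorizations_diags_pos:
  assumes "s \<le> t" "t \<le> M"
  shows "1 \<le> card (grid.factorizations M (t - s) (diags M s t))"
proof -
  define c where "c = (\<lambda>e\<in>diags M s t. (fst e + snd e) mod M - s)"
  have "inj_on c (diags M s t \<inter> v)" if v: "v \<in> row_stars M \<union> col_stars M" for v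
  proof (rule inj_onI)
    fix e e' assume e: "e \<in> diags M s t \<inter> v" "e' \<in> diags M s t \<inter> v" "c e = c e'"
    then have eq: "(fst e + snd e) mod M = (fst e' + snd e') mod M" by (auto simp: c_def diags_def)
    have M: "0 < M" using e by (auto simp: diags_def)
    have rng: "fst e \<in> {1..M}" "snd e \<in> {1..M}" "fst e' \<in> {1..M}" "snd e' \<in> {1..M}"
      using e by (auto simp: diags_def)
    have "fst e = fst e' \<or> snd e = snd e'" using v e by (auto simp: row_stars_def col_stars_def)
    then show "e = e'"
    proof
      assume 1: "fst e = fst e'"
      have "snd e = snd e'"
        using eq rng bij_betw_shift_mod[OF M, of "fst e"] 1 by (auto simp: bij_betw_def dest: inj_onD)
      with 1 show ?thesis by (simp add: prod_eq_iff)
    next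
      assume 1: "snd e = snd e'"
      have "fst e = fst e'"
        using eq rng bij_betw_shift_mod[OF M, of "snd e"] 1
        by (auto simp: bij_betw_def add.commute dest: inj_onD)
      with 1 show ?thesis by (simp add: prod_eq_iff)
    qed
  qed
  moreover have "c \<in> diags M s t \<rightarrow>\<^sub>E {..<t - s}"
    unfolding c_def by (auto simp: diags_def)
  ultimately have "c \<in> grid.factorizations M (t - s) (diags M s t)"
    by (simp add: grid.factorizations_def)
  then show ?thesis
    using grid.finite_factorizations[OF grid.finite_regular[OF regular_diags[OF assms]]]
    by (auto simp: Suc_le_eq card_gt_0_iff)
qed

lemma card_factorizations_diags_union:
  assumes "s \<le> t" "t \<le> M"
  shows "card (grid.factorizations M s (diags M 0 s)) * card (grid.factorizations M (t - s) (diags M s t))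
    \<le> card (grid.factorizations M t (diags M 0 t))"
proof -
  have "diags M 0 s \<union> diags M s t = diags M 0 t" "diags M 0 s \<inter> diags M s t = {}"
    using assms by (auto simp: diags_def)
  moreover have "finite (diags M s t)" for s t
    by (rule finite_subset[of _ "{1..M} \<times> {1..M}"]) (auto simp: diags_def)
  ultimately show ?thesis
    using grid.card_factorizations_union_ge[of "diags M 0 s" "diags M s t" M s "t - s"] assms by simp
qed

text \<open>The diagonals fall into \<open>h\<close> bands of degree \<open>2 ^ a\<close>. With
  \<open>2 * M\<close> stars, the halving bound gives each band at least
  \<open>2 ^ (M * a * 2 ^ a) / 2 ^ (4 * M * 2 ^ a)\<close> factorizations, and factorizations of
  different bands combine freely.\<close>

lemma card_factorizations_diags_ge:
  assumes M: "2 \<le> M" and h: "2 ^ a * h \<le> M"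
  shows "2 ^ (M * a * 2 ^ a * h)
    \<le> card (grid.factorizations M (2 ^ a * h) (diags M 0 (2 ^ a * h))) * 2 ^ (4 * M * 2 ^ a * h)"
  using h
proof (induction h)
  case 0
  then show ?case using card_factorizations_diags_pos[of 0 0 M] by simp
next
  case (Suc h)
  define D where "D = (2 :: nat) ^ a"
  have le: "D * h \<le> D * Suc h" "D * Suc h \<le> M" using Suc.prems by (auto simp: D_def)
  define F where "F t = card (grid.factorizations M t (diags M 0 t))" for t
  define G where "G = card (grid.factorizations M D (diags M (D * h) (D * Suc h)))"
  have "grid.regular M (2 ^ a) (diags M (D * h) (D * Suc h))"
    using regular_diags[OF le] by (simp add: D_def)
  from grid.card_factorizations_pow2_ge[OF this]
  have "2 ^ (2 * M * (a * D + 2 * a + 4)) \<le> G\<^sup>2 * 2 ^ (2 * M * (4 * D))"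
    using card_grid_stars[OF M] by (simp add: G_def D_def)
  moreover have "(2 :: nat) ^ (2 * (M * a * D)) \<le> 2 ^ (2 * M * (a * D + 2 * a + 4))"
    by (rule power_increasing) (simp_all add: algebra_simps)
  ultimately have "2 ^ (2 * (M * a * D)) \<le> G\<^sup>2 * 2 ^ (2 * M * (4 * D))" by (rule order_trans[rotated])
  then have "(2 ^ (M * a * D))\<^sup>2 \<le> (G * 2 ^ (4 * M * D))\<^sup>2"
    by (simp add: power_mult_distrib power_mult[symmetric] mult_ac)
  then have 1: "2 ^ (M * a * D) \<le> G * 2 ^ (4 * M * D)"
    by (rule power2_le_imp_le) simp
  have 2: "F (D * h) * G \<le> F (D * Suc h)"
    using card_factorizations_diags_union[OF le] by (simp add: F_def G_def)
  have 3: "2 ^ (M * a * D * h) \<le> F (D * h) * 2 ^ (4 * M * D * h)"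
    using Suc.IH le by (simp add: D_def F_def)
  have "2 ^ (M * a * D * Suc h) = (2 :: nat) ^ (M * a * D * h) * 2 ^ (M * a * D)"
    by (simp add: power_add)
  also have "\<dots> \<le> (F (D * h) * 2 ^ (4 * M * D * h)) * (G * 2 ^ (4 * M * D))"
    using 1 3 by (intro mult_mono) auto
  also have "\<dots> = (F (D * h) * G) * 2 ^ (4 * M * D * Suc h)"
  proof -
    have "4 * M * D * Suc h = 4 * M * D * h + 4 * M * D" by simp
    then show ?thesis by (simp only: power_add mult_ac)
  qed
  also have "\<dots> \<le> F (D * Suc h) * 2 ^ (4 * M * D * Suc h)"
    using 2 by (rule mult_right_mono) simp
  finally show ?case by (simp add: F_def D_def)
qed

lemma finite_latin_squares: "finite (latin_squares n)"
  by (rule finite_subset[of _ "({1..n} \<times> {1..n}) \<rightarrow>\<^sub>E {1..n}"])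
    (auto simp: latin_squares_def finite_PiE)

text \<open>With \<open>M\<close> colours, being injective on a row or column of \<open>M\<close>
  cells means being bijective there, so raising the colours by one gives a Latin square.\<close>

lemma card_factorizations_le_latin_squares:
  "card (grid.factorizations M M (diags M 0 M)) \<le> card (latin_squares M)"
proof (rule card_inj_on_le)
  define E where "E = {1..M} \<times> {1..M}"
  have E: "diags M 0 M = E" by (auto simp: diags_def E_def)
  define L where "L c = (\<lambda>e\<in>E. c e + 1)" for c :: "nat \<times> nat \<Rightarrow> nat"
  show "inj_on L (grid.factorizations M M (diags M 0 M))"
  proof (rule inj_onI)
    fix c c' assume c: "c \<in> grid.factorizations M M (diags M 0 M)"
      "c' \<in> grid.factorizations M M (diags M 0 M)" and eq: "L c = L c'"
    then have mem: "c \<in> E \<rightarrow>\<^sub>E {..<M}" "c' \<in> E \<rightarrow>\<^sub>E {..<M}" by (auto simp: grid.factorizations_def E)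
    have "c e = c' e" if "e \<in> E" for e using fun_cong[OF eq, of e] that by (simp add: L_def)
    then show "c = c'" using PiE_ext[OF mem] by simp
  qed
  show "L ` grid.factorizations M M (diags M 0 M) \<subseteq> latin_squares M"
  proof (rule image_subsetI)
    fix c assume "c \<in> grid.factorizations M M (diags M 0 M)"
    then have c: "c \<in> E \<rightarrow>\<^sub>E {..<M}" "\<And>v. v \<in> row_stars M \<union> col_stars M \<Longrightarrow> inj_on c (E \<inter> v)"
      by (auto simp: grid.factorizations_def E)
    \<comment> \<open>Here \<open>f\<close> parametrizes a row or a column, so that both are treated
      at once.\<close>
    have bij: "\<exists>!j. j \<in> {1..M} \<and> L c (f j) = s"
      if s: "s \<in> {1..M}" and f: "inj_on f {1..M}" "f ` {1..M} \<subseteq> E" "inj_on c (f ` {1..M})" for f s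
    proof -
      have "inj_on (\<lambda>j. L c (f j)) {1..M}"
      proof (rule inj_onI)
        fix j k assume jk: "j \<in> {1..M}" "k \<in> {1..M}" "L c (f j) = L c (f k)"
        moreover have "f j \<in> E" "f k \<in> E" using jk f(2) by auto
        ultimately have "c (f j) = c (f k)" by (simp add: L_def)
        then have "f j = f k" using f(3) jk by (auto dest: inj_onD)
        then show "j = k" using f(1) jk by (auto dest: inj_onD)
      qed
      moreover have "(\<lambda>j. L c (f j)) ` {1..M} \<subseteq> {1..M}"
        using c(1) f(2) by (fastforce simp: L_def)
      ultimately have inj: "inj_on (\<lambda>j. L c (f j)) {1..M}" and "(\<lambda>j. L c (f j)) ` {1..M} = {1..M}"
        by (simp_all add: endo_inj_surj)
      then obtain j where "j \<in> {1..M}" "L c (f j) = s" using s by (metis (no_types, lifting) imageE)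
      then show ?thesis using inj by (intro ex1I[of _ j]) (auto dest: inj_onD)
    qed
    have "\<exists>!j. j \<in> {1..M} \<and> L c (i, j) = s" if "i \<in> {1..M}" "s \<in> {1..M}" for i s
    proof (rule bij)
      have "Pair i ` {1..M} \<subseteq> E \<inter> ({i} \<times> {1..M})" using that by (auto simp: E_def)
      then show "inj_on c (Pair i ` {1..M})"
        using c(2)[of "{i} \<times> {1..M}"] that inj_on_subset by (auto simp: row_stars_def)
    qed (use that in \<open>auto simp: inj_on_def E_def\<close>)
    moreover have "\<exists>!i. i \<in> {1..M} \<and> L c (i, j) = s" if "j \<in> {1..M}" "s \<in> {1..M}" for j s
    proof (rule bij)
      have "(\<lambda>i. (i, j)) ` {1..M} \<subseteq> E \<inter> ({1..M} \<times> {j})" using that by (auto simp: E_def)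
      then show "inj_on c ((\<lambda>i. (i, j)) ` {1..M})"
        using c(2)[of "{1..M} \<times> {j}"] that inj_on_subset by (auto simp: col_stars_def)
    qed (use that in \<open>auto simp: inj_on_def E_def\<close>)
    moreover have "L c \<in> E \<rightarrow>\<^sub>E {1..M}"
    proof -
      have "c e < M" if "e \<in> E" for e using c(1) that by auto
      then show ?thesis by (auto simp: L_def Suc_le_eq)
    qed
    ultimately show "L c \<in> latin_squares M" by (simp add: latin_squares_def E_def)
  qed
qed (rule finite_latin_squares)

text \<open>The diagonals left over beyond \<open>2 ^ a * h\<close> have at least their cyclic
  factorization, so every factorization of the first ones extends to a Latin square.\<close>

lemma card_latin_squares_ge:
  assumes M: "2 \<le> M" and h: "2 ^ a * h \<le> M"
  shows "2 ^ (M * a * 2 ^ a * h) \<le> card (latin_squares M) * 2 ^ (4 * M * 2 ^ a * h)"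
proof -
  have "card (grid.factorizations M (2 ^ a * h) (diags M 0 (2 ^ a * h))) \<le> card (latin_squares M)"
    using card_factorizations_diags_union[OF h, of M]
      card_factorizations_diags_pos[OF h, of M] card_factorizations_le_latin_squares[of M]
    by (metis (no_types, lifting) le_trans mult.right_neutral mult_le_mono2 order_refl)
  then show ?thesis
    using card_factorizations_diags_ge[OF assms] by (meson le_trans mult_le_mono1)
qed

lemma latin_squares_nonempty: "latin_squares n \<noteq> {}"
  using card_factorizations_diags_pos[of 0 n n] card_factorizations_le_latin_squares[of n] by force

text \<open>This crude bound already has the right leading order in the exponent, which is all that
  the final comparison uses.\<close>

lemma card_latin_squares_le: "card (latin_squares n) \<le> n ^ (n * n)"
proof -
  have "card (latin_squares n) \<le> card (({1..n} \<times> {1..n}) \<rightarrow>\<^sub>E {1..n})"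
    by (rule card_mono) (auto simp: latin_squares_def finite_PiE)
  then show ?thesis by (simp add: card_funcsetE)
qed

section \<open>Extreme points of line polytopes\<close>

lemma lookup_scaleR: "Poly_Mapping.lookup (r *\<^sub>R x) k = r * Poly_Mapping.lookup x k" for x :: "'a \<Rightarrow>\<^sub>0 real"
proof -
  have "finite {i. r *\<^sub>R Poly_Mapping.lookup x i \<noteq> 0}"
    by (rule finite_subset[OF _ finite_lookup[of x]]) auto
  then show ?thesis by (simp add: scaleR_poly_mapping_def)
qed

text \<open>The directions of the lines are forgotten, since the arguments on vertices only use
  nonnegativity and the sum on each line.\<close>

definition line_polytope :: "'a set set \<Rightarrow> ('a \<Rightarrow>\<^sub>0 real) set" where
  "line_polytope Ls = {A. Poly_Mapping.keys A \<subseteq> \<Union>Ls \<and> (\<forall>x. 0 \<le> Poly_Mapping.lookup A x) \<and>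
    (\<forall>l\<in>Ls. (\<Sum>x\<in>l. Poly_Mapping.lookup A x) = 1)}"

text \<open>If \<open>B\<close> is supported on the support of \<open>A\<close>, then moving from \<open>B\<close> through \<open>A\<close> and beyond, one
  leaves the polytope at a point with smaller support.\<close>

lemma line_polytope_subtract:
  assumes A: "A \<in> line_polytope Ls" and B: "B \<in> line_polytope Ls" and t: "t < 1"
    and le: "\<And>x. t * Poly_Mapping.lookup B x \<le> Poly_Mapping.lookup A x"
    and keys: "Poly_Mapping.keys B \<subseteq> Poly_Mapping.keys A"
  shows "(1 / (1 - t)) *\<^sub>R (A - t *\<^sub>R B) \<in> line_polytope Ls" (is "?C \<in> _")
    and "Poly_Mapping.keys ((1 / (1 - t)) *\<^sub>R (A - t *\<^sub>R B)) \<subseteq> Poly_Mapping.keys A"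
proof -
  have C: "Poly_Mapping.lookup ?C x = (Poly_Mapping.lookup A x - t * Poly_Mapping.lookup B x) / (1 - t)" for x
    by (simp add: lookup_scaleR lookup_minus)
  show sub: "Poly_Mapping.keys ?C \<subseteq> Poly_Mapping.keys A"
  proof
    fix x assume "x \<in> Poly_Mapping.keys ?C"
    then have "Poly_Mapping.lookup A x \<noteq> 0 \<or> Poly_Mapping.lookup B x \<noteq> 0"
      using C[of x] by (auto simp: in_keys_iff)
    then show "x \<in> Poly_Mapping.keys A" using keys by (auto simp: in_keys_iff)
  qed
  have "(\<Sum>x\<in>l. Poly_Mapping.lookup ?C x) = 1" if "l \<in> Ls" for l
  proof -
    have "(\<Sum>x\<in>l. Poly_Mapping.lookup ?C x)
        = ((\<Sum>x\<in>l. Poly_Mapping.lookup A x) - t * (\<Sum>x\<in>l. Poly_Mapping.lookup B x)) / (1 - t)"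
      unfolding C by (simp add: sum_subtractf sum_distrib_left flip: sum_divide_distrib)
    then show ?thesis using A B that t by (simp add: line_polytope_def)
  qed
  moreover have "Poly_Mapping.lookup ?C x \<ge> 0" for x using C le[of x] t by simp
  ultimately show "?C \<in> line_polytope Ls"
    using sub A by (auto simp: line_polytope_def)
qed

text \<open>For \<open>t \<ge> 1\<close> the point \<open>B\<close> lies below \<open>A\<close>
  entrywise, and equal line sums then force equality.\<close>

lemma line_polytope_ratio:
  assumes A: "A \<in> line_polytope Ls" and B: "B \<in> line_polytope Ls"
    and fin: "\<And>l. l \<in> Ls \<Longrightarrow> finite l"
    and le: "\<And>x. t * Poly_Mapping.lookup B x \<le> Poly_Mapping.lookup A x" and ne: "A \<noteq> B"
  shows "t < 1"
proof (rule ccontr)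
  assume "\<not> t < 1"
  then have t: "1 \<le> t" by simp
  have BA: "Poly_Mapping.lookup B x \<le> Poly_Mapping.lookup A x" for x
  proof -
    have "1 * Poly_Mapping.lookup B x \<le> t * Poly_Mapping.lookup B x"
      using t B by (intro mult_right_mono) (auto simp: line_polytope_def)
    then show ?thesis using le[of x] by simp
  qed
  have "Poly_Mapping.lookup A x = Poly_Mapping.lookup B x" for x
  proof (cases "x \<in> \<Union>Ls")
    case True
    then obtain l where l: "l \<in> Ls" "x \<in> l" by blast
    have "(\<Sum>x\<in>l. Poly_Mapping.lookup A x - Poly_Mapping.lookup B x) = 0"
      using A B l by (simp add: line_polytope_def sum_subtractf)
    then show ?thesis
      using BA l fin[OF l(1)] by (subst (asm) sum_nonneg_eq_0_iff) auto
  next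
    case False
    then have "x \<notin> Poly_Mapping.keys A" "x \<notin> Poly_Mapping.keys B" using A B by (auto simp: line_polytope_def)
    then show ?thesis by (simp add: in_keys_iff)
  qed
  then show False using ne by (simp add: poly_mapping_eq_iff fun_eq_iff)
qed

text \<open>Otherwise the segment from \<open>B\<close> to \<open>A\<close> could be prolonged a
  little beyond \<open>A\<close> inside the polytope, so that \<open>A\<close> would be an inner
  point of a segment.\<close>

lemma extreme_point_line_polytope_keys:
  assumes A: "A extreme_point_of line_polytope Ls" and B: "B \<in> line_polytope Ls"
    and keys: "Poly_Mapping.keys B \<subseteq> Poly_Mapping.keys A"
  shows "B = A"
proof (rule ccontr)
  assume ne: "B \<noteq> A"
  have A': "A \<in> line_polytope Ls" using A by (simp add: extreme_point_of_def)
  have A0: "0 \<le> Poly_Mapping.lookup A x" and B0: "0 \<le> Poly_Mapping.lookup B x" for x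
    using A' B by (simp_all add: line_polytope_def)
  \<comment> \<open>Adding one in the denominator keeps \<open>q\<close> defined where
    \<open>B\<close> vanishes; the value \<open>1 / 2\<close> in the minimum below ensures
    \<open>t < 1\<close>.\<close>
  define q where "q x = Poly_Mapping.lookup A x / (Poly_Mapping.lookup B x + 1)" for x
  define t where "t = Min (insert (1 / 2) (q ` Poly_Mapping.keys A))"
  have "0 < q x" if "x \<in> Poly_Mapping.keys A" for x
    using that A0[of x] B0[of x] by (auto simp: q_def in_keys_iff)
  then have "0 < t" by (simp add: t_def)
  have "t \<le> 1 / 2" unfolding t_def by (rule Min_le) simp_all
  with \<open>0 < t\<close> have t: "0 < t" "t < 1" by simp_all
  have le: "t * Poly_Mapping.lookup B x \<le> Poly_Mapping.lookup A x" for x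
  proof (cases "x \<in> Poly_Mapping.keys A")
    case True
    then have "t \<le> q x" by (simp add: t_def)
    then have "t * (Poly_Mapping.lookup B x + 1) \<le> Poly_Mapping.lookup A x"
      using B0[of x] by (simp add: q_def pos_le_divide_eq)
    then show ?thesis using t by (simp add: algebra_simps)
  next
    case False
    then have "x \<notin> Poly_Mapping.keys B" using keys by auto
    then show ?thesis using A0[of x] by (simp add: in_keys_iff)
  qed
  define C where "C = (1 / (1 - t)) *\<^sub>R (A - t *\<^sub>R B)"
  have C: "C \<in> line_polytope Ls"
    using line_polytope_subtract(1)[OF A' B t(2) le keys] by (simp add: C_def)
  have "A = (1 - t) *\<^sub>R C + t *\<^sub>R B" using t by (simp add: C_def)
  moreover from this have "C \<noteq> B" using ne by (auto simp flip: scaleR_add_left)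
  ultimately have "A \<in> open_segment C B" using t by (auto simp: in_segment)
  then show False using A B C by (simp add: extreme_point_of_def)
qed

text \<open>A point of minimal support inside the support of \<open>A\<close> is the only point on
  its own support, and this makes it extreme.\<close>

lemma extreme_point_line_polytope_exists:
  assumes A: "A \<in> line_polytope Ls" and fin: "\<And>l. l \<in> Ls \<Longrightarrow> finite l"
  obtains V where "V extreme_point_of line_polytope Ls" "Poly_Mapping.keys V \<subseteq> Poly_Mapping.keys A"
proof -
  obtain V where V: "V \<in> line_polytope Ls" "Poly_Mapping.keys V \<subseteq> Poly_Mapping.keys A"
    and min: "\<And>B. B \<in> line_polytope Ls \<Longrightarrow> Poly_Mapping.keys B \<subseteq> Poly_Mapping.keys A \<Longrightarrow>
      card (Poly_Mapping.keys V) \<le> card (Poly_Mapping.keys B)"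
    using ex_has_least_nat[of "\<lambda>V. V \<in> line_polytope Ls \<and> Poly_Mapping.keys V \<subseteq> Poly_Mapping.keys A" A
        "\<lambda>V. card (Poly_Mapping.keys V)"] A by blast
  have rigid: "B = V" if B: "B \<in> line_polytope Ls" and keys: "Poly_Mapping.keys B \<subseteq> Poly_Mapping.keys V" for B
  proof (rule ccontr)
    assume ne: "B \<noteq> V"
    have V0: "0 \<le> Poly_Mapping.lookup V x" and B0: "0 \<le> Poly_Mapping.lookup B x" for x
      using V B by (simp_all add: line_polytope_def)
    have nonempty: "Poly_Mapping.keys B \<noteq> {}"
    proof
      assume empty: "Poly_Mapping.keys B = {}"
      then have "Poly_Mapping.lookup B x = 0" for x by (simp flip: not_in_keys_iff_lookup_eq_zero)
      then have "Ls = {}" using B by (auto simp: line_polytope_def)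
      then have "Poly_Mapping.keys V = {}" using V by (simp add: line_polytope_def)
      then show False using empty ne by simp
    qed
    \<comment> \<open>Now \<open>t\<close> is the exact smallest ratio, so that subtracting
      \<open>t *\<^sub>R B\<close> kills an entry and shrinks the support.\<close>
    define q where "q x = Poly_Mapping.lookup V x / Poly_Mapping.lookup B x" for x
    define t where "t = Min (q ` Poly_Mapping.keys B)"
    have le: "t * Poly_Mapping.lookup B x \<le> Poly_Mapping.lookup V x" for x
    proof (cases "x \<in> Poly_Mapping.keys B")
      case True
      then have "t \<le> q x" "0 < Poly_Mapping.lookup B x"
        using B0[of x] by (auto simp: t_def in_keys_iff)
      then show ?thesis by (simp add: q_def pos_le_divide_eq)
    next
      case False
      then show ?thesis using V0[of x] by (simp add: in_keys_iff)
    qed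
    have t: "t < 1" using line_polytope_ratio[OF V(1) B fin le] ne by auto
    define C where "C = (1 / (1 - t)) *\<^sub>R (V - t *\<^sub>R B)"
    have C: "C \<in> line_polytope Ls" "Poly_Mapping.keys C \<subseteq> Poly_Mapping.keys V"
      using line_polytope_subtract[OF V(1) B t le keys] by (simp_all add: C_def)
    have "t \<in> q ` Poly_Mapping.keys B" unfolding t_def using nonempty by (intro Min_in) auto
    then obtain x where x: "x \<in> Poly_Mapping.keys B" "t = q x" by blast
    then have "Poly_Mapping.lookup C x = 0"
      by (simp add: C_def lookup_scaleR lookup_minus q_def in_keys_iff)
    then have "x \<notin> Poly_Mapping.keys C" by (simp add: in_keys_iff)
    then have "Poly_Mapping.keys C \<subset> Poly_Mapping.keys V" using C(2) x keys by auto
    then have "card (Poly_Mapping.keys C) < card (Poly_Mapping.keys V)" by (intro psubset_card_mono) auto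
    moreover have "card (Poly_Mapping.keys V) \<le> card (Poly_Mapping.keys C)" using min C V(2) by auto
    ultimately show False by simp
  qed
  have "V \<notin> open_segment B C" if B: "B \<in> line_polytope Ls" and C: "C \<in> line_polytope Ls" for B C
  proof
    assume "V \<in> open_segment B C"
    then obtain u where u: "B \<noteq> C" "0 < u" "u < 1" "V = (1 - u) *\<^sub>R B + u *\<^sub>R C"
      by (auto simp: in_segment)
    have B0: "0 \<le> Poly_Mapping.lookup B x" and C0: "0 \<le> Poly_Mapping.lookup C x" for x
      using B C by (simp_all add: line_polytope_def)
    \<comment> \<open>Both weights are positive and all entries nonnegative, so a zero of
      \<open>V\<close> is a zero of both ends.\<close>
    have "Poly_Mapping.lookup B x = 0 \<and> Poly_Mapping.lookup C x = 0" if "Poly_Mapping.lookup V x = 0" for x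
    proof -
      have "(1 - u) * Poly_Mapping.lookup B x + u * Poly_Mapping.lookup C x = 0"
        using that u(4) by (simp add: lookup_add lookup_scaleR)
      moreover have "0 \<le> (1 - u) * Poly_Mapping.lookup B x" "0 \<le> u * Poly_Mapping.lookup C x"
        using u B0[of x] C0[of x] by simp_all
      ultimately have "(1 - u) * Poly_Mapping.lookup B x = 0" "u * Poly_Mapping.lookup C x = 0" by linarith+
      then show ?thesis using u by simp
    qed
    then have "Poly_Mapping.keys B \<subseteq> Poly_Mapping.keys V" "Poly_Mapping.keys C \<subseteq> Poly_Mapping.keys V"
      by (auto simp: in_keys_iff)
    then show False using rigid B C u(1) by blast
  qed
  then have "V extreme_point_of line_polytope Ls" using V(1) by (simp add: extreme_point_of_def)
  then show ?thesis using V(2) that by blast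
qed

text \<open>A vertex is determined by its support, which is one of finitely many sets.\<close>

lemma finite_extreme_points_line_polytope:
  assumes "finite (\<Union>Ls)"
  shows "finite {V. V extreme_point_of line_polytope Ls}"
proof (rule inj_on_finite)
  show "inj_on Poly_Mapping.keys {V. V extreme_point_of line_polytope Ls}"
  proof (rule inj_onI)
    fix V W assume "V \<in> {V. V extreme_point_of line_polytope Ls}" "W \<in> {V. V extreme_point_of line_polytope Ls}"
      and "Poly_Mapping.keys V = Poly_Mapping.keys W"
    then show "V = W"
      by (intro extreme_point_line_polytope_keys) (auto simp: extreme_point_of_def)
  qed
  show "Poly_Mapping.keys ` {V. V extreme_point_of line_polytope Ls} \<subseteq> Pow (\<Union>Ls)"
    by (auto simp: extreme_point_of_def line_polytope_def)
qed (use assms in simp)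

section \<open>Tristochastic arrays as a line polytope\<close>

definition array_lines :: "nat \<Rightarrow> (nat \<times> nat \<times> nat) set set" where
  "array_lines n = (\<lambda>(j, k). (\<lambda>i. (i, j, k)) ` {1..n}) ` ({1..n} \<times> {1..n})
    \<union> (\<lambda>(i, k). (\<lambda>j. (i, j, k)) ` {1..n}) ` ({1..n} \<times> {1..n})
    \<union> (\<lambda>(i, j). (\<lambda>k. (i, j, k)) ` {1..n}) ` ({1..n} \<times> {1..n})"

lemma Union_array_lines: "\<Union>(array_lines n) = {1..n} \<times> {1..n} \<times> {1..n}"
  unfolding array_lines_def by (auto simp: image_iff)

lemma finite_array_line: "l \<in> array_lines n \<Longrightarrow> finite l"
  by (auto simp: array_lines_def)

lemma tristochastic_eq_line_polytope: "tristochastic n = line_polytope (array_lines n)"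
proof -
  have sum_line: "(\<Sum>x\<in>(\<lambda>i. (i, j, k)) ` {1..n}. f x) = (\<Sum>i=1..n. f (i, j, k))"
    "(\<Sum>x\<in>(\<lambda>i. (j, i, k)) ` {1..n}. f x) = (\<Sum>i=1..n. f (j, i, k))"
    "(\<Sum>x\<in>(\<lambda>i. (j, k, i)) ` {1..n}. f x) = (\<Sum>i=1..n. f (j, k, i))"
    for j k and f :: "nat \<times> nat \<times> nat \<Rightarrow> real"
    by (subst sum.reindex; auto simp: inj_on_def)+
  have nonneg: "(\<forall>i\<in>{1..n}. \<forall>j\<in>{1..n}. \<forall>k\<in>{1..n}. 0 \<le> Poly_Mapping.lookup A (i, j, k))
      \<longleftrightarrow> (\<forall>x. 0 \<le> Poly_Mapping.lookup A x)"
    if "Poly_Mapping.keys A \<subseteq> {1..n} \<times> {1..n} \<times> {1..n}" for A :: array3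
  proof -
    have "Poly_Mapping.lookup A x = 0" if "x \<notin> {1..n} \<times> {1..n} \<times> {1..n}" for x
      using that \<open>Poly_Mapping.keys A \<subseteq> _\<close> by (auto simp flip: not_in_keys_iff_lookup_eq_zero)
    then show ?thesis by (metis (no_types, lifting) SigmaE mem_Sigma_iff order_refl)
  qed
  have lines: "(\<forall>l\<in>array_lines n. sum f l = 1) \<longleftrightarrow>
      (\<forall>j\<in>{1..n}. \<forall>k\<in>{1..n}. (\<Sum>i=1..n. f (i, j, k)) = 1) \<and>
      (\<forall>i\<in>{1..n}. \<forall>k\<in>{1..n}. (\<Sum>j=1..n. f (i, j, k)) = 1) \<and>
      (\<forall>i\<in>{1..n}. \<forall>j\<in>{1..n}. (\<Sum>k=1..n. f (i, j, k)) = 1)"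
    for f :: "nat \<times> nat \<times> nat \<Rightarrow> real"
    by (simp only: array_lines_def ball_Un ball_simps split_paired_Ball_Sigma prod.case sum_line conj_assoc)
  show ?thesis
    unfolding tristochastic_def line_polytope_def arrays3_def Union_array_lines lines
    using nonneg by (intro Collect_cong) blast
qed

section \<open>Block arrays with two cubes on each line\<close>

text \<open>Cyclic permutation of the coordinates: lines are treated in the third direction only,
  and applying \<open>rot\<close> once or twice transfers the results to the other two.\<close>

definition rot :: "('a \<Rightarrow> 'a \<Rightarrow> 'a \<Rightarrow> 'b) \<Rightarrow> 'a \<Rightarrow> 'a \<Rightarrow> 'a \<Rightarrow> 'b" where
  "rot f = (\<lambda>y z x. f x y z)"

definition rot_cells :: "('a \<Rightarrow> 'a \<Rightarrow> 'a \<Rightarrow> 'b \<Rightarrow> 'b \<Rightarrow> 'b \<Rightarrow> 'c) \<Rightarrow> 'a \<Rightarrow> 'a \<Rightarrow> 'a \<Rightarrow> 'b \<Rightarrow> 'b \<Rightarrow> 'b \<Rightarrow> 'c" where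
  "rot_cells \<Lambda> = (\<lambda>y z x. rot (\<Lambda> x y z))"

text \<open>Constrains the third direction only; the others are covered by requiring it of
  \<open>rot W\<close> and \<open>rot (rot W)\<close>. Lines of cubes with \<open>x = y\<close> are
  left to the constant blocks.\<close>

definition pair_design :: "nat \<Rightarrow> (nat \<Rightarrow> nat \<Rightarrow> nat \<Rightarrow> bool) \<Rightarrow> bool" where
  "pair_design q W \<longleftrightarrow> (\<forall>x y z. W x y z \<longrightarrow> x < q \<and> y < q \<and> z < q \<and> x \<noteq> y) \<and>
    (\<forall>x<q. \<forall>y<q. x \<noteq> y \<longrightarrow> card {z. W x y z} = 2)"

text \<open>Inside a selected cube the cells form the graph of a function. Together with both
  rotations this describes a Latin square.\<close>

definition functional_cells ::
  "nat \<Rightarrow> (nat \<Rightarrow> nat \<Rightarrow> nat \<Rightarrow> bool) \<Rightarrow> (nat \<Rightarrow> nat \<Rightarrow> nat \<Rightarrow> nat \<Rightarrow> nat \<Rightarrow> nat \<Rightarrow> bool) \<Rightarrow> bool" where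
  "functional_cells M W \<Lambda> \<longleftrightarrow> (\<forall>x y z a b. W x y z \<longrightarrow> a \<in> {1..M} \<longrightarrow> b \<in> {1..M} \<longrightarrow>
    (\<exists>!c. c \<in> {1..M} \<and> \<Lambda> x y z a b c))"

text \<open>The indices \<open>1..q * M + r\<close> with \<open>r \<le> M\<close> fall into the blocks \<open>0, \<dots>, q - 1\<close> of size \<open>M\<close> and
  a remainder block \<open>q\<close> of size \<open>r\<close>.\<close>

definition idx :: "nat \<Rightarrow> nat \<Rightarrow> nat \<Rightarrow> nat" where
  "idx M x a = x * M + a"

definition blk :: "nat \<Rightarrow> nat \<Rightarrow> nat" where
  "blk M i = (i - 1) div M"

definition loc :: "nat \<Rightarrow> nat \<Rightarrow> nat" where
  "loc M i = (i - 1) mod M + 1"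

text \<open>The diagonal cubes pass the share \<open>r / M\<close> of each of their lines on to the remainder block. For \<open>r = 0\<close>
  the junk value \<open>1 / r\<close> is never attained at indices in range.\<close>

definition block_array ::
  "nat \<Rightarrow> nat \<Rightarrow> nat \<Rightarrow> (nat \<Rightarrow> nat \<Rightarrow> nat \<Rightarrow> bool) \<Rightarrow> (nat \<Rightarrow> nat \<Rightarrow> nat \<Rightarrow> nat \<Rightarrow> nat \<Rightarrow> nat \<Rightarrow> bool)
    \<Rightarrow> nat \<Rightarrow> nat \<Rightarrow> nat \<Rightarrow> real" where
  "block_array q M r W \<Lambda> i j k =
    (let x = blk M i; y = blk M j; z = blk M k in
      if W x y z then (if \<Lambda> x y z (loc M i) (loc M j) (loc M k) then 1 / 2 else 0)
      else if x = y \<and> y = z then (if x = q then 1 / real r else (1 - real r / real M) / real M)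
      else if x = y \<and> z = q \<or> y = z \<and> x = q \<or> z = x \<and> y = q then 1 / real M else 0)"

lemma block_array_rot: "block_array q M r W \<Lambda> i j k = block_array q M r (rot W) (rot_cells \<Lambda>) j k i"
  unfolding block_array_def rot_def rot_cells_def Let_def by (intro if_cong) auto

lemma block_array_nonneg:
  assumes "r \<le> M"
  shows "0 \<le> block_array q M r W \<Lambda> i j k"
proof -
  have "real r / real M \<le> 1" unfolding divide_le_eq_1 using assms by auto
  then have "0 \<le> (1 - real r / real M) / real M" by (intro divide_nonneg_nonneg) auto
  moreover have "0 \<le> (if A then (if B then 1 / 2 else 0) else if C then (if D then 1 / real r else x)
      else if E then 1 / real M else 0)" if "0 \<le> x" for A B C D E and x :: real
    using that by simp
  ultimately show ?thesis unfolding block_array_def Let_def by blast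
qed

lemma blk_idx: "a \<in> {1..M} \<Longrightarrow> blk M (idx M x a) = x"
  and loc_idx: "a \<in> {1..M} \<Longrightarrow> loc M (idx M x a) = a"
proof -
  assume a: "a \<in> {1..M}"
  then obtain b where b: "a = Suc b" "b < M" by (cases a) auto
  then show "blk M (idx M x a) = x" "loc M (idx M x a) = a" by (simp_all add: blk_def loc_def idx_def)
qed

lemma idx_blk_loc: "1 \<le> i \<Longrightarrow> idx M (blk M i) (loc M i) = i"
  unfolding idx_def blk_def loc_def using div_mult_mod_eq[of "i - 1" M] by linarith

lemma loc_in: "0 < M \<Longrightarrow> loc M i \<in> {1..M}"
  by (simp add: loc_def Suc_le_eq)

lemma blk_le:
  assumes "i \<in> {1..q * M + r}" "r \<le> M"
  shows "blk M i \<le> q"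
proof -
  have "i - 1 < Suc q * M" using assms by (simp, linarith)
  then have "(i - 1) div M < Suc q" by (rule less_mult_imp_div_less)
  then show ?thesis by (simp add: blk_def)
qed

lemma idx_in: "x < q \<Longrightarrow> a \<in> {1..M} \<Longrightarrow> idx M x a \<in> {1..q * M + r}"
proof -
  assume "x < q" "a \<in> {1..M}"
  moreover from this have "Suc x * M \<le> q * M" by (intro mult_le_mono1) simp
  ultimately show ?thesis by (auto simp: idx_def)
qed

lemma sum_blocks:
  fixes f :: "nat \<Rightarrow> real"
  shows "(\<Sum>k=1..q * M + r. f k) = (\<Sum>z<q. \<Sum>c=1..M. f (idx M z c)) + (\<Sum>c=1..r. f (idx M q c))"
proof -
  have shift: "(\<Sum>k=1..N + m. f k) = (\<Sum>k=1..N. f k) + (\<Sum>c=1..m. f (N + c))" for N m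
    by (induction m) (auto simp: add.assoc)
  have "(\<Sum>k=1..q * M. f k) = (\<Sum>z<q. \<Sum>c=1..M. f (idx M z c))"
  proof (induction q)
    case (Suc q)
    have "(\<Sum>k=1..Suc q * M. f k) = (\<Sum>k=1..q * M + M. f k)" by (simp add: add.commute)
    then show ?case using Suc shift[of "q * M" M] by (simp add: idx_def)
  qed auto
  then show ?thesis using shift[of "q * M" r] by (simp add: idx_def)
qed

text \<open>For distinct \<open>x\<close>, \<open>y\<close> below \<open>q\<close> two cubes give
  \<open>1 / 2\<close> each. For \<open>x = y < q\<close> the diagonal cube gives
  \<open>1 - r / M\<close> and the remainder \<open>r / M\<close>. With one fixed index in the
  remainder, \<open>M\<close> entries \<open>1 / M\<close> add up; with both, \<open>r\<close>
  entries \<open>1 / r\<close>.\<close>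

lemma block_array_line_sum:
  assumes W: "pair_design q W" and \<Lambda>: "functional_cells M W \<Lambda>" and M: "0 < M" and r: "r \<le> M"
    and i: "i \<in> {1..q * M + r}" and j: "j \<in> {1..q * M + r}"
  shows "(\<Sum>k=1..q * M + r. block_array q M r W \<Lambda> i j k) = 1"
proof -
  define x y where "x = blk M i" and "y = blk M j"
  have xy: "x \<le> q" "y \<le> q" using blk_le i j r by (auto simp: x_def y_def)
  have rpos: "0 < r" if "x = q"
  proof (rule ccontr)
    assume "\<not> 0 < r"
    then have "i - 1 < q * M" using i by auto
    then have "(i - 1) div M < q" by (rule less_mult_imp_div_less)
    then show False using that by (simp add: x_def blk_def)
  qed
  define g where "g z = (\<Sum>c=1..M. block_array q M r W \<Lambda> i j (idx M z c))" for z
  define h where "h = (\<Sum>c=1..r. block_array q M r W \<Lambda> i j (idx M q c))"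
  have gW: "g z = 1 / 2" if "W x y z" for z
  proof -
    have "\<exists>!c. c \<in> {1..M} \<and> \<Lambda> x y z (loc M i) (loc M j) c"
      using \<Lambda> that loc_in[OF M] by (simp add: functional_cells_def)
    then obtain c0 where c0: "c0 \<in> {1..M}" "\<And>c. c \<in> {1..M} \<Longrightarrow> \<Lambda> x y z (loc M i) (loc M j) c \<longleftrightarrow> c = c0"
      by (elim ex1E) blast
    have "g z = (\<Sum>c=1..M. if c = c0 then 1 / 2 else 0)"
      unfolding g_def
    proof (rule sum.cong)
      fix c assume "c \<in> {1..M}"
      then show "block_array q M r W \<Lambda> i j (idx M z c) = (if c = c0 then 1 / 2 else 0)"
        using that c0(2)[of c] by (simp add: block_array_def x_def y_def blk_idx loc_idx)
    qed simp
    then show ?thesis using c0(1) by simp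
  qed
  have gn: "g z = real M * (if x = y \<and> y = z then (if x = q then 1 / real r else (1 - real r / real M) / real M)
      else if x = y \<and> z = q \<or> y = z \<and> x = q \<or> z = x \<and> y = q then 1 / real M else 0)"
    if "\<not> W x y z" for z
  proof -
    have "g z = (\<Sum>c=1..M. if x = y \<and> y = z then (if x = q then 1 / real r else (1 - real r / real M) / real M)
      else if x = y \<and> z = q \<or> y = z \<and> x = q \<or> z = x \<and> y = q then 1 / real M else 0)"
      unfolding g_def
      using that by (intro sum.cong) (simp_all add: block_array_def x_def y_def blk_idx Let_def)
    then show ?thesis by simp
  qed
  have nWq: "\<not> W x y q" and nWx: "\<not> W x q z" "\<not> W q y z" "\<not> W x x z" for z
    using W by (auto simp: pair_design_def)
  have h: "h = real r * (if x = y \<and> y = q then 1 / real r else if x = y then 1 / real M else 0)"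
  proof -
    have "h = (\<Sum>c=1..r. if x = y \<and> y = q then 1 / real r else if x = y then 1 / real M else 0)"
      unfolding h_def
    proof (rule sum.cong)
      fix c assume "c \<in> {1..r}"
      then have "c \<in> {1..M}" using r by auto
      then show "block_array q M r W \<Lambda> i j (idx M q c)
          = (if x = y \<and> y = q then 1 / real r else if x = y then 1 / real M else 0)"
        using nWq by (auto simp: block_array_def blk_idx Let_def simp flip: x_def y_def)
    qed simp
    then show ?thesis by simp
  qed
  have "(\<Sum>z<q. g z) + h = 1"
  proof -
    consider "x = q" "y = q" | "x = q" "y < q" | "x < q" "y = q" | "x < q" "x = y" | "x < q" "y < q" "x \<noteq> y"
      using xy by linarith
    then show ?thesis
    proof cases
      case 1
      then have "g z = 0" if "z < q" for z using gn[of z] nWx that by auto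
      then show ?thesis using h 1 rpos by simp
    next
      case 2
      then have "g z = (if z = y then 1 else 0)" if "z < q" for z using gn[of z] nWx that M by auto
      then show ?thesis using h 2 by simp
    next
      case 3
      then have "g z = (if z = x then 1 else 0)" if "z < q" for z using gn[of z] nWx that M by auto
      then show ?thesis using h 3 by simp
    next
      case 4
      then have "g z = (if z = x then 1 - real r / real M else 0)" if "z < q" for z
        using gn[of z] nWx that M by auto
      then show ?thesis using h 4 by simp
    next
      case 5
      have "g z = (if W x y z then 1 / 2 else 0)" if "z < q" for z
        using gn[of z] gW[of z] 5 that by auto
      then have "(\<Sum>z<q. g z) = (\<Sum>z<q. if W x y z then 1 / 2 else 0)" by simp
      also have "\<dots> = (\<Sum>z\<in>{z. W x y z}. 1 / 2)"
      proof -
        have "{z \<in> {..<q}. W x y z} = {z. W x y z}" using W by (auto simp: pair_design_def)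
        then show ?thesis by (simp flip: sum.inter_filter)
      qed
      also have "\<dots> = 1" using W 5 by (simp add: pair_design_def)
      finally show ?thesis using h 5 by simp
    qed
  qed
  then show ?thesis unfolding sum_blocks g_def h_def .
qed

text \<open>A line through selected cubes meets the support in just one cell of each of its two
  cubes, so a zero line sum makes the two entries opposite.\<close>

lemma block_array_negate:
  fixes D :: "nat \<Rightarrow> nat \<Rightarrow> nat \<Rightarrow> real"
  assumes W: "pair_design q W" and \<Lambda>: "functional_cells M W \<Lambda>" and M: "0 < M" and r: "r \<le> M"
    and supp: "\<And>i j k. block_array q M r W \<Lambda> i j k = 0 \<Longrightarrow> D i j k = 0"
    and sum: "\<And>i j. i \<in> {1..q * M + r} \<Longrightarrow> j \<in> {1..q * M + r} \<Longrightarrow> (\<Sum>k=1..q * M + r. D i j k) = 0"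
    and w: "W x y z" "W x y z'" "z \<noteq> z'"
    and abc: "a \<in> {1..M}" "b \<in> {1..M}" "c \<in> {1..M}" "c' \<in> {1..M}" "\<Lambda> x y z a b c" "\<Lambda> x y z' a b c'"
  shows "D (idx M x a) (idx M y b) (idx M z' c') = - D (idx M x a) (idx M y b) (idx M z c)"
proof -
  define i j k k' where "i = idx M x a" and "j = idx M y b" and "k = idx M z c" and "k' = idx M z' c'"
  have rng: "x < q" "y < q" "x \<noteq> y" "z < q" "z' < q" using W w by (auto simp: pair_design_def)
  have mem: "i \<in> {1..q * M + r}" "j \<in> {1..q * M + r}" "k \<in> {1..q * M + r}" "k' \<in> {1..q * M + r}"
    using idx_in rng abc by (auto simp: i_def j_def k_def k'_def)
  have zs: "{z, z'} = {z. W x y z}"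
  proof (rule card_seteq)
    have "card {z. W x y z} = 2" using W rng by (simp add: pair_design_def)
    then show "finite {z. W x y z}" "card {z. W x y z} \<le> card {z, z'}"
      using w by (auto intro: card_ge_0_finite)
  qed (use w in auto)
  have zz: "v = z \<or> v = z'" if "W x y v" for v
  proof -
    have "v \<in> {z, z'}" unfolding zs using that by simp
    then show ?thesis by simp
  qed
  have other: "D i j m = 0" if m: "m \<in> {1..q * M + r} - {k, k'}" for m
  proof (rule supp, rule ccontr)
    assume "block_array q M r W \<Lambda> i j m \<noteq> 0"
    then have 1: "W x y (blk M m)" "\<Lambda> x y (blk M m) a b (loc M m)"
    proof -
      have b: "blk M i = x" "blk M j = y" "loc M i = a" "loc M j = b"
        using abc by (simp_all add: i_def j_def blk_idx loc_idx)
      have "x \<noteq> q" "y \<noteq> q" using rng by simp_all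
      then show "W x y (blk M m)" "\<Lambda> x y (blk M m) a b (loc M m)"
        using \<open>block_array q M r W \<Lambda> i j m \<noteq> 0\<close> rng(3)
        unfolding block_array_def Let_def b by argo+
    qed
    have 2: "m = idx M (blk M m) (loc M m)" using idx_blk_loc[of m M] m by simp
    have uniq: "d = d'" if "W x y v" "d \<in> {1..M}" "d' \<in> {1..M}" "\<Lambda> x y v a b d" "\<Lambda> x y v a b d'" for v d d'
    proof -
      have "\<exists>!d. d \<in> {1..M} \<and> \<Lambda> x y v a b d"
        using \<Lambda> that(1) abc(1,2) by (simp add: functional_cells_def)
      then show ?thesis using that(2-5) by blast
    qed
    from zz[OF 1(1)] show False
    proof
      assume v: "blk M m = z"
      then have "loc M m = c" using uniq[OF w(1) loc_in[OF M] abc(3)] 1 abc by simp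
      then show False using 2 v m by (simp add: k_def)
    next
      assume v: "blk M m = z'"
      then have "loc M m = c'" using uniq[OF w(2) loc_in[OF M] abc(4)] 1 abc by simp
      then show False using 2 v m by (simp add: k'_def)
    qed
  qed
  have "blk M k = z" "blk M k' = z'" using abc by (simp_all add: k_def k'_def blk_idx)
  then have "k \<noteq> k'" using w(3) by auto
  have "0 = (\<Sum>m=1..q * M + r. D i j m)" using sum mem by simp
  also have "\<dots> = (\<Sum>m\<in>{k, k'}. D i j m)"
    using mem other by (intro sum.mono_neutral_right) auto
  also have "\<dots> = D i j k + D i j k'" using \<open>k \<noteq> k'\<close> by simp
  finally show ?thesis by (simp add: i_def j_def k_def k'_def)
qed

section \<open>The outer design\<close>

fun cube_adjacent :: "nat \<times> nat \<times> nat \<Rightarrow> nat \<times> nat \<times> nat \<Rightarrow> bool" where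
  "cube_adjacent (x, y, z) (x', y', z') \<longleftrightarrow>
    x = x' \<and> y = y' \<and> z \<noteq> z' \<or> y = y' \<and> z = z' \<and> x \<noteq> x' \<or> z = z' \<and> x = x' \<and> y \<noteq> y'"

text \<open>Among the pairs \<open>(d, e)\<close> every nonzero residue modulo \<open>7\<close> occurs twice as \<open>d\<close>, twice as \<open>e\<close> and
  twice as \<open>e - d\<close>. The pairs were found by a computer search for a design with a short odd closed
  walk.\<close>

definition design :: "(nat \<times> nat \<times> nat) list" where
  "design = [(x, (x + d) mod 7, (x + e) mod 7). x \<leftarrow> [0..<7],
    (d, e) \<leftarrow> [(1, 2), (1, 3), (2, 1), (2, 6), (3, 5), (3, 6), (4, 2), (4, 5), (5, 1), (5, 4), (6, 3), (6, 4)]]"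

definition odd_walk :: "(nat \<times> nat \<times> nat) list" where
  "odd_walk = [(0, 1, 2), (0, 1, 3), (0, 6, 3), (4, 6, 3), (4, 0, 3), (4, 0, 2), (4, 1, 2)]"

text \<open>Breadth-first search along \<open>cube_adjacent\<close>. Each round filters
  \<open>design\<close>, so the result keeps its order and connectedness becomes an equality of
  lists, decided by evaluation.\<close>

fun spread :: "nat \<Rightarrow> (nat \<times> nat \<times> nat) list \<Rightarrow> (nat \<times> nat \<times> nat) list" where
  "spread 0 ws = ws"
| "spread (Suc n) ws = spread n (filter (\<lambda>w. \<exists>v\<in>set ws. v = w \<or> cube_adjacent v w) design)"

lemma design_spread: "spread 9 [(0, 1, 2)] = design"
  by code_simp

lemma design_lines:
  "\<forall>x\<in>set [0..<7]. \<forall>y\<in>set [0..<7]. x \<noteq> y \<longrightarrow>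
    length (filter (\<lambda>z. (x, y, z) \<in> set design) [0..<7]) = 2 \<and>
    length (filter (\<lambda>z. (z, x, y) \<in> set design) [0..<7]) = 2 \<and>
    length (filter (\<lambda>z. (y, z, x) \<in> set design) [0..<7]) = 2"
  by code_simp

lemma design_range: "\<forall>(x, y, z)\<in>set design. x < 7 \<and> y < 7 \<and> z < 7 \<and> x \<noteq> y \<and> y \<noteq> z \<and> z \<noteq> x"
  by code_simp

lemma odd_walk_adjacent: "\<forall>t\<in>set [0..<7]. cube_adjacent (odd_walk ! t) (odd_walk ! (Suc t mod 7))"
  by code_simp

lemma odd_walk_design: "set odd_walk \<subseteq> set design"
  by code_simp

text \<open>The \<open>7 * 12 = 84\<close> cubes of the design less the seven on the walk.\<close>

lemma card_free_cubes: "length (remdups (filter (\<lambda>w. w \<notin> set odd_walk) design)) = 77"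
  by code_simp

section \<open>Triviality of the kernel of the line sums\<close>

definition line_kernel ::
  "nat \<Rightarrow> nat \<Rightarrow> nat \<Rightarrow> (nat \<Rightarrow> nat \<Rightarrow> nat \<Rightarrow> bool) \<Rightarrow> (nat \<Rightarrow> nat \<Rightarrow> nat \<Rightarrow> nat \<Rightarrow> nat \<Rightarrow> nat \<Rightarrow> bool)
    \<Rightarrow> (nat \<Rightarrow> nat \<Rightarrow> nat \<Rightarrow> real) \<Rightarrow> bool" where
  "line_kernel q M r W \<Lambda> D \<longleftrightarrow> pair_design q W \<and> functional_cells M W \<Lambda> \<and>
    (\<forall>i j k. block_array q M r W \<Lambda> i j k = 0 \<longrightarrow> D i j k = 0) \<and>
    (\<forall>i\<in>{1..q * M + r}. \<forall>j\<in>{1..q * M + r}. (\<Sum>k=1..q * M + r. D i j k) = 0)"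

definition cube_vanishes ::
  "nat \<Rightarrow> (nat \<Rightarrow> nat \<Rightarrow> nat \<Rightarrow> nat \<Rightarrow> nat \<Rightarrow> nat \<Rightarrow> bool) \<Rightarrow> (nat \<Rightarrow> nat \<Rightarrow> nat \<Rightarrow> real) \<Rightarrow> nat \<Rightarrow> nat \<Rightarrow> nat \<Rightarrow> bool" where
  "cube_vanishes M \<Lambda> D x y z \<longleftrightarrow> (\<forall>a\<in>{1..M}. \<forall>b\<in>{1..M}. \<forall>c\<in>{1..M}.
    \<Lambda> x y z a b c \<longrightarrow> D (idx M x a) (idx M y b) (idx M z c) = 0)"

lemma line_kernel_negate:
  assumes "line_kernel q M r W \<Lambda> D" "0 < M" "r \<le> M" "W x y z" "W x y z'" "z \<noteq> z'"
    and "a \<in> {1..M}" "b \<in> {1..M}" "c \<in> {1..M}" "c' \<in> {1..M}" "\<Lambda> x y z a b c" "\<Lambda> x y z' a b c'"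
  shows "D (idx M x a) (idx M y b) (idx M z' c') = - D (idx M x a) (idx M y b) (idx M z c)"
  using assms by (intro block_array_negate[of q W M \<Lambda> r]) (auto simp: line_kernel_def)

text \<open>Every cell of the second cube shares its line with a cell of the first, where
  \<open>D\<close> is zero.\<close>

lemma line_kernel_vanishes:
  assumes ker: "line_kernel q M r W \<Lambda> D" and M: "0 < M" "r \<le> M" and w: "W x y z" "W x y z'" "z \<noteq> z'"
    and van: "cube_vanishes M \<Lambda> D x y z"
  shows "cube_vanishes M \<Lambda> D x y z'"
  unfolding cube_vanishes_def
proof (intro ballI impI)
  fix a b c' assume abc: "a \<in> {1..M}" "b \<in> {1..M}" "c' \<in> {1..M}" "\<Lambda> x y z' a b c'"
  have "\<exists>!c. c \<in> {1..M} \<and> \<Lambda> x y z a b c"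
    using ker w(1) abc by (simp add: line_kernel_def functional_cells_def)
  then obtain c where c: "c \<in> {1..M}" "\<Lambda> x y z a b c" by blast
  have "D (idx M x a) (idx M y b) (idx M z c) = 0"
    using van abc c by (simp add: cube_vanishes_def)
  then show "D (idx M x a) (idx M y b) (idx M z' c') = 0"
    using line_kernel_negate[OF ker M w abc(1,2) c(1) abc(3) c(2) abc(4)] by simp
qed

lemma cube_vanishes_rot: "cube_vanishes M (rot_cells \<Lambda>) (rot D) y z x \<longleftrightarrow> cube_vanishes M \<Lambda> D x y z"
  unfolding cube_vanishes_def rot_cells_def rot_def by blast

text \<open>Along the walk all cubes have the same cells, so a cell keeps its inner coordinates
  while \<open>D\<close> changes sign at each step. After an odd number of steps \<open>D\<close>
  equals its own negative at the start, and connectedness spreads the zero to all cubes.\<close>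

lemma block_kernel_trivial:
  assumes ker: "line_kernel q M r W \<Lambda> D" "line_kernel q M r (rot W) (rot_cells \<Lambda>) (rot D)"
      "line_kernel q M r (rot (rot W)) (rot_cells (rot_cells \<Lambda>)) (rot (rot D))"
    and M: "0 < M" "r \<le> M"
    and walk: "\<And>t. t < m \<Longrightarrow> cube_adjacent (u t) (u (Suc t))" "u m = u 0" "odd m"
      "\<And>t x y z. t \<le> m \<Longrightarrow> u t = (x, y, z) \<Longrightarrow> W x y z \<and> \<Lambda> x y z = \<Lambda>\<^sub>0"
    and conn: "\<And>X. u 0 \<in> X \<Longrightarrow> (\<And>v x y z. v \<in> X \<Longrightarrow> cube_adjacent v (x, y, z) \<Longrightarrow> W x y z \<Longrightarrow> (x, y, z) \<in> X)
      \<Longrightarrow> {(x, y, z). W x y z} \<subseteq> X"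
    and w: "W x y z"
  shows "cube_vanishes M \<Lambda> D x y z"
proof -
  define d where "d w a b c = (case w of (x, y, z) \<Rightarrow> D (idx M x a) (idx M y b) (idx M z c))" for w a b c
  have neg: "d (u (Suc t)) a b c = - d (u t) a b c"
    if t: "t < m" and abc: "a \<in> {1..M}" "b \<in> {1..M}" "c \<in> {1..M}" "\<Lambda>\<^sub>0 a b c" for t a b c
  proof -
    obtain x y z x' y' z' where u: "u t = (x, y, z)" "u (Suc t) = (x', y', z')"
      by (metis prod_cases3)
    have W: "W x y z" "W x' y' z'" "\<Lambda> x y z = \<Lambda>\<^sub>0" "\<Lambda> x' y' z' = \<Lambda>\<^sub>0"
      using walk(4)[of t] walk(4)[of "Suc t"] u t by auto
    \<comment> \<open>The coordinate that changes decides which of the three rotated kernels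
      applies.\<close>
    from walk(1)[OF t] consider "x = x'" "y = y'" "z \<noteq> z'" | "y = y'" "z = z'" "x \<noteq> x'" | "z = z'" "x = x'" "y \<noteq> y'"
      by (auto simp: u)
    then show ?thesis
    proof cases
      case 1
      then show ?thesis
        using line_kernel_negate[OF ker(1) M, of x y z z' a b c c] W abc by (simp add: d_def u)
    next
      case 2
      then show ?thesis
        using line_kernel_negate[OF ker(2) M, of y z x x' b c a a] W abc
        by (simp add: d_def u rot_def rot_cells_def)
    next
      case 3
      then show ?thesis
        using line_kernel_negate[OF ker(3) M, of z x y y' c a b b] W abc
        by (simp add: d_def u rot_def rot_cells_def)
    qed
  qed
  have alt: "d (u t) a b c = (-1) ^ t * d (u 0) a b c"
    if "t \<le> m" "a \<in> {1..M}" "b \<in> {1..M}" "c \<in> {1..M}" "\<Lambda>\<^sub>0 a b c" for t a b c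
    using that by (induction t) (simp_all add: neg)
  \<comment> \<open>At \<open>t = m\<close> the walk is back at \<open>u 0\<close> with the sign
    \<open>-1\<close>.\<close>
  have zero: "d (u 0) a b c = 0" if "a \<in> {1..M}" "b \<in> {1..M}" "c \<in> {1..M}" "\<Lambda>\<^sub>0 a b c" for a b c
    using alt[OF order_refl that] walk(2,3) by simp
  define X where "X = {(x, y, z). W x y z \<and> cube_vanishes M \<Lambda> D x y z}"
  have "u 0 \<in> X"
  proof -
    obtain x y z where u: "u 0 = (x, y, z)" by (metis prod_cases3)
    then show ?thesis
      using walk(4)[of 0 x y z] zero by (simp add: X_def cube_vanishes_def d_def)
  qed
  moreover have "(x', y', z') \<in> X" if "v \<in> X" "cube_adjacent v (x', y', z')" "W x' y' z'" for v x' y' z'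
  proof -
    obtain x y z where v: "v = (x, y, z)" by (metis prod_cases3)
    have van: "W x y z" "cube_vanishes M \<Lambda> D x y z" using that(1) by (auto simp: X_def v)
    from that(2) consider "x = x'" "y = y'" "z \<noteq> z'" | "y = y'" "z = z'" "x \<noteq> x'" | "z = z'" "x = x'" "y \<noteq> y'"
      by (auto simp: v)
    then have "cube_vanishes M \<Lambda> D x' y' z'"
    proof cases
      case 1
      then show ?thesis using line_kernel_vanishes[OF ker(1) M, of x y z z'] van that(3) by simp
    next
      case 2
      then show ?thesis
        using line_kernel_vanishes[OF ker(2) M, of y z x x'] van that(3)
        by (simp add: cube_vanishes_rot) (simp add: rot_def)
    next
      case 3
      then show ?thesis
        using line_kernel_vanishes[OF ker(3) M, of z x y y'] van that(3)
        by (simp add: cube_vanishes_rot) (simp add: rot_def)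
    qed
    then show ?thesis using that(3) by (simp add: X_def)
  qed
  ultimately have "{(x, y, z). W x y z} \<subseteq> X" by (rule conn)
  then show ?thesis using w by (auto simp: X_def)
qed

definition design_cube :: "nat \<Rightarrow> nat \<Rightarrow> nat \<Rightarrow> bool" where
  "design_cube x y z \<longleftrightarrow> (x, y, z) \<in> set design"

lemma pair_design_design_cube:
  "pair_design 7 design_cube" "pair_design 7 (rot design_cube)" "pair_design 7 (rot (rot design_cube))"
proof -
  have rng: "x < 7 \<and> y < 7 \<and> z < 7 \<and> x \<noteq> y \<and> y \<noteq> z \<and> z \<noteq> x" if "design_cube x y z" for x y z
    using design_range that by (auto simp: design_cube_def)
  have card: "card {z. P z} = 2" if "length (filter P [0..<7]) = 2" "\<And>z. P z \<Longrightarrow> z < 7" for P :: "nat \<Rightarrow> bool"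
  proof -
    have "{z. P z} = set (filter P [0..<7])" using that(2) by auto
    then show ?thesis using that(1) by (simp add: distinct_card del: set_filter)
  qed
  have cards: "card {z. design_cube x y z} = 2" "card {z. design_cube z x y} = 2" "card {z. design_cube y z x} = 2"
    if "x < 7" "y < 7" "x \<noteq> y" for x y
  proof -
    have "x \<in> set [0..<7]" "y \<in> set [0..<7]" using that by simp_all
    then show "card {z. design_cube x y z} = 2" "card {z. design_cube z x y} = 2" "card {z. design_cube y z x} = 2"
      using design_lines that(3) rng by (intro card; auto simp: design_cube_def simp del: upt.simps)+
  qed
  show "pair_design 7 design_cube" "pair_design 7 (rot design_cube)" "pair_design 7 (rot (rot design_cube))"
    unfolding pair_design_def rot_def using rng cards by blast+
qed

text \<open>A set closed under adjacency within the design contains every stage of the search, whose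
  last stage is the whole design.\<close>

lemma design_connected:
  assumes X: "(0, 1, 2) \<in> X"
    and step: "\<And>v x y z. v \<in> X \<Longrightarrow> cube_adjacent v (x, y, z) \<Longrightarrow> design_cube x y z \<Longrightarrow> (x, y, z) \<in> X"
  shows "{(x, y, z). design_cube x y z} \<subseteq> X"
proof -
  have "set (spread n ws) \<subseteq> X" if "set ws \<subseteq> X" for n ws
    using that
  proof (induction n arbitrary: ws)
    case (Suc n)
    have "set (filter (\<lambda>w. \<exists>v\<in>set ws. v = w \<or> cube_adjacent v w) design) \<subseteq> X"
      using Suc.prems step by (auto simp: design_cube_def)
    then show ?case using Suc.IH by simp
  qed simp
  from this[of "[(0, 1, 2)]" 9] show ?thesis
    unfolding design_spread using X by (auto simp: design_cube_def)
qed

section \<open>Vertices from Latin squares\<close>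

definition latin_cells :: "(nat \<times> nat \<times> nat \<Rightarrow> nat \<times> nat \<Rightarrow> nat) \<Rightarrow> nat \<Rightarrow> nat \<Rightarrow> nat \<Rightarrow> nat \<Rightarrow> nat \<Rightarrow> nat \<Rightarrow> bool" where
  "latin_cells L x y z a b c \<longleftrightarrow> L (x, y, z) (a, b) = c"

text \<open>The three rotations express that the entry is a function of the cell, and the column and
  row conditions of a Latin square.\<close>

lemma functional_cells_latin:
  assumes "\<And>w. L w \<in> latin_squares M"
  shows "functional_cells M W (latin_cells L)" "functional_cells M (rot W) (rot_cells (latin_cells L))"
    "functional_cells M (rot (rot W)) (rot_cells (rot_cells (latin_cells L)))"
proof -
  have L: "L w (a, b) \<in> {1..M}" "\<exists>!j. j \<in> {1..M} \<and> L w (a, j) = b" "\<exists>!i. i \<in> {1..M} \<and> L w (i, a) = b"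
    if "a \<in> {1..M}" "b \<in> {1..M}" for w a b
    using assms[of w] that by (auto simp: latin_squares_def)
  show "functional_cells M W (latin_cells L)"
    unfolding functional_cells_def latin_cells_def using L(1) by blast
  show "functional_cells M (rot W) (rot_cells (latin_cells L))"
    unfolding functional_cells_def latin_cells_def rot_cells_def rot_def using L(3) by blast
  show "functional_cells M (rot (rot W)) (rot_cells (rot_cells (latin_cells L)))"
    unfolding functional_cells_def latin_cells_def rot_cells_def rot_def using L(2) by blast
qed

text \<open>The cut-off is what makes the support finite, as \<open>block_array\<close> can be
  nonzero on diagonal blocks beyond the index range.\<close>

definition latin_array :: "nat \<Rightarrow> nat \<Rightarrow> (nat \<times> nat \<times> nat \<Rightarrow> nat \<times> nat \<Rightarrow> nat) \<Rightarrow> array3" where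
  "latin_array M r L = Abs_poly_mapping (\<lambda>(i, j, k).
    if i \<in> {1..7 * M + r} \<and> j \<in> {1..7 * M + r} \<and> k \<in> {1..7 * M + r}
    then block_array 7 M r design_cube (latin_cells L) i j k else 0)"

lemma lookup_latin_array:
  "Poly_Mapping.lookup (latin_array M r L) (i, j, k) =
    (if i \<in> {1..7 * M + r} \<and> j \<in> {1..7 * M + r} \<and> k \<in> {1..7 * M + r}
     then block_array 7 M r design_cube (latin_cells L) i j k else 0)"
proof -
  define f where "f = (\<lambda>(i, j, k).
    if i \<in> {1..7 * M + r} \<and> j \<in> {1..7 * M + r} \<and> k \<in> {1..7 * M + r}
    then block_array 7 M r design_cube (latin_cells L) i j k else 0)"
  have "{x. f x \<noteq> 0} \<subseteq> {1..7 * M + r} \<times> {1..7 * M + r} \<times> {1..7 * M + r}"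
    by (auto simp: f_def split: if_splits)
  then have "finite {x. f x \<noteq> 0}" by (rule finite_subset) simp
  then have "Poly_Mapping.lookup (latin_array M r L) = f"
    unfolding latin_array_def f_def[symmetric] by simp
  then show ?thesis by (simp add: f_def)
qed

lemma latin_array_tristochastic:
  assumes M: "0 < M" "r \<le> M" and L: "\<And>w. L w \<in> latin_squares M"
  shows "latin_array M r L \<in> tristochastic (7 * M + r)"
proof -
  define n where "n = 7 * M + r"
  define B where "B = block_array 7 M r design_cube (latin_cells L)"
  note fc = functional_cells_latin[OF L]
  have lk: "Poly_Mapping.lookup (latin_array M r L) (i, j, k) = B i j k"
    if "i \<in> {1..n}" "j \<in> {1..n}" "k \<in> {1..n}" for i j k
    using that by (simp add: lookup_latin_array n_def B_def)
  have keys: "Poly_Mapping.keys (latin_array M r L) \<subseteq> {1..n} \<times> {1..n} \<times> {1..n}"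
    by (auto simp: in_keys_iff lookup_latin_array n_def split: if_splits)
  have s1: "(\<Sum>k=1..n. B i j k) = 1" if "i \<in> {1..n}" "j \<in> {1..n}" for i j
    unfolding B_def n_def using that
    by (intro block_array_line_sum pair_design_design_cube fc M) (simp_all add: n_def)
  \<comment> \<open>Rotating once makes \<open>i\<close> the last index; rotating twice below does
    the same for \<open>j\<close>.\<close>
  have s2: "(\<Sum>i=1..n. B i j k) = 1" if "j \<in> {1..n}" "k \<in> {1..n}" for j k
    unfolding B_def n_def block_array_rot[of 7 M r design_cube] using that
    by (intro block_array_line_sum pair_design_design_cube fc M) (simp_all add: n_def)
  have s3: "(\<Sum>j=1..n. B i j k) = 1" if "i \<in> {1..n}" "k \<in> {1..n}" for i k
    unfolding B_def n_def block_array_rot[of 7 M r design_cube] block_array_rot[of 7 M r "rot design_cube"]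
    using that by (intro block_array_line_sum pair_design_design_cube fc M) (simp_all add: n_def)
  have "0 \<le> B i j k" for i j k unfolding B_def using M by (intro block_array_nonneg)
  then show ?thesis
    unfolding tristochastic_def arrays3_def n_def[symmetric] using keys s1 s2 s3 lk by simp
qed

text \<open>The difference of the array and any point of its face lies in the kernel of the line sums.\<close>

lemma latin_array_face:
  assumes M: "0 < M" "r \<le> M" and L: "\<And>w. L w \<in> latin_squares M"
    and same: "\<And>v w. v \<in> set odd_walk \<Longrightarrow> w \<in> set odd_walk \<Longrightarrow> L v = L w"
    and V: "V \<in> tristochastic (7 * M + r)"
    and keys: "Poly_Mapping.keys V \<subseteq> Poly_Mapping.keys (latin_array M r L)"
    and w: "design_cube x y z" and abc: "a \<in> {1..M}" "b \<in> {1..M}" "c \<in> {1..M}"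
  shows "Poly_Mapping.lookup V (idx M x a, idx M y b, idx M z c) = (if L (x, y, z) (a, b) = c then 1 / 2 else 0)"
proof -
  define n where "n = 7 * M + r"
  define A where "A = latin_array M r L"
  define D where "D i j k = Poly_Mapping.lookup A (i, j, k) - Poly_Mapping.lookup V (i, j, k)" for i j k
  note fc = functional_cells_latin[OF L]
  have A: "A \<in> tristochastic n" using latin_array_tristochastic[OF M L] by (simp add: A_def n_def)
  have A0: "Poly_Mapping.lookup V p = 0" if "Poly_Mapping.lookup A p = 0" for p
    using keys that unfolding A_def[symmetric] by (meson in_keys_iff subsetD)
  have D0: "D i j k = 0" if "block_array 7 M r design_cube (latin_cells L) i j k = 0" for i j k
  proof -
    have "Poly_Mapping.lookup A (i, j, k) = 0" using that by (simp add: A_def lookup_latin_array)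
    then show ?thesis using A0 by (simp add: D_def)
  qed
  have D0': "rot D j k i = 0" if "block_array 7 M r (rot design_cube) (rot_cells (latin_cells L)) j k i = 0" for i j k
  proof -
    have "block_array 7 M r design_cube (latin_cells L) i j k = 0"
      using that by (subst block_array_rot)
    then show ?thesis using D0 by (simp add: rot_def)
  qed
  have D0'': "rot (rot D) k i j = 0"
    if "block_array 7 M r (rot (rot design_cube)) (rot_cells (rot_cells (latin_cells L))) k i j = 0" for i j k
  proof -
    have "block_array 7 M r (rot design_cube) (rot_cells (latin_cells L)) j k i = 0"
      using that by (subst block_array_rot)
    then have "rot D j k i = 0" by (rule D0')
    then show ?thesis by (simp add: rot_def)
  qed
  have V': "V \<in> tristochastic n" using V by (simp add: n_def)
  have sums: "(\<Sum>k=1..n. D i j k) = 0" "(\<Sum>k=1..n. D k i j) = 0" "(\<Sum>k=1..n. D i k j) = 0"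
    if "i \<in> {1..n}" "j \<in> {1..n}" for i j
    using A V' that by (simp_all add: tristochastic_def D_def sum_subtractf)
  have ker: "line_kernel 7 M r design_cube (latin_cells L) D"
    "line_kernel 7 M r (rot design_cube) (rot_cells (latin_cells L)) (rot D)"
    "line_kernel 7 M r (rot (rot design_cube)) (rot_cells (rot_cells (latin_cells L))) (rot (rot D))"
    unfolding line_kernel_def n_def[symmetric]
    using pair_design_design_cube fc D0 D0' D0'' sums by (simp_all add: rot_def)
  define u where "u t = odd_walk ! (t mod 7)" for t
  define L0 where "L0 a b c \<longleftrightarrow> L (0, 1, 2) (a, b) = c" for a b c
  have u_in: "u t \<in> set odd_walk" for t
    unfolding u_def by (rule nth_mem) (simp add: odd_walk_def)
  have "cube_vanishes M (latin_cells L) D x y z"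
  proof (rule block_kernel_trivial[OF ker M, where m = 7 and u = u and \<Lambda>\<^sub>0 = L0])
    show "cube_adjacent (u t) (u (Suc t))" if "t < 7" for t
      using odd_walk_adjacent that by (simp add: u_def del: upt.simps)
    show "design_cube x y z \<and> latin_cells L x y z = L0" if "u t = (x, y, z)" for t x y z
    proof -
      have 1: "(x, y, z) \<in> set odd_walk" using u_in[of t] that by simp
      then have "L (x, y, z) = L (0, 1, 2)" by (rule same) (simp add: odd_walk_def)
      then show ?thesis
        using 1 odd_walk_design by (auto simp: design_cube_def latin_cells_def L0_def fun_eq_iff)
    qed
    show "{(x, y, z). design_cube x y z} \<subseteq> X"
      if "u 0 \<in> X" "\<And>v x y z. v \<in> X \<Longrightarrow> cube_adjacent v (x, y, z) \<Longrightarrow> design_cube x y z \<Longrightarrow> (x, y, z) \<in> X" for X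
    proof (rule design_connected)
      show "(0, 1, 2) \<in> X" using that(1) by (simp add: u_def odd_walk_def)
    qed (rule that(2))
    show "u 7 = u 0" by (simp add: u_def)
  qed (use w in auto)
  then have van: "D (idx M x a) (idx M y b) (idx M z c) = 0" if "L (x, y, z) (a, b) = c"
    using abc that unfolding cube_vanishes_def latin_cells_def by blast
  have rng: "x < 7" "y < 7" "z < 7" using w design_range by (auto simp: design_cube_def)
  have lkA: "Poly_Mapping.lookup A (idx M x a, idx M y b, idx M z c) = (if L (x, y, z) (a, b) = c then 1 / 2 else 0)"
    using idx_in[of x 7 a M r] idx_in[of y 7 b M r] idx_in[of z 7 c M r] rng abc w
    by (simp add: A_def lookup_latin_array block_array_def blk_idx loc_idx latin_cells_def)
  \<comment> \<open>On Latin cells \<open>V\<close> agrees with the array because \<open>D\<close>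
    vanishes there; off them the array is zero, and so is \<open>V\<close>.\<close>
  show ?thesis
  proof (cases "L (x, y, z) (a, b) = c")
    case True
    then show ?thesis using van lkA by (simp add: D_def)
  next
    case False
    then show ?thesis using lkA A0 by simp
  qed
qed

lemma finite_extreme_points_tristochastic: "finite {A. A extreme_point_of tristochastic n}"
  unfolding tristochastic_eq_line_polytope
  by (rule finite_extreme_points_line_polytope) (simp add: Union_array_lines)

text \<open>For each choice of squares on the \<open>77\<close> free cubes a vertex is taken on the
  support of its array. Its entries \<open>1 / 2\<close> in the free cubes spell out the chosen
  squares, so different choices give different vertices.\<close>

lemma card_extreme_points_ge:
  assumes M: "0 < M" "r \<le> M"
  shows "card (latin_squares M) ^ 77 \<le> card {A. A extreme_point_of tristochastic (7 * M + r)}"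
proof -
  define n where "n = 7 * M + r"
  define F where "F = set design - set odd_walk"
  have cardF: "card F = 77"
  proof -
    have "F = set (remdups (filter (\<lambda>w. w \<notin> set odd_walk) design))" by (auto simp: F_def)
    then show ?thesis using card_free_cubes by (metis distinct_card distinct_remdups)
  qed
  obtain L0 where L0: "L0 \<in> latin_squares M" using latin_squares_nonempty by blast
  \<comment> \<open>The default \<open>L0\<close> puts one common square on all cubes of the
    walk.\<close>
  define ext where "ext \<phi> w = (if w \<in> F then \<phi> w else L0)"
    for \<phi> :: "nat \<times> nat \<times> nat \<Rightarrow> nat \<times> nat \<Rightarrow> nat" and w
  define \<Phi> where "\<Phi> = F \<rightarrow>\<^sub>E latin_squares M"
  have ext: "ext \<phi> w \<in> latin_squares M" if "\<phi> \<in> \<Phi>" for \<phi> w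
    using that L0 by (auto simp: ext_def \<Phi>_def)
  have "\<exists>V. V extreme_point_of tristochastic n \<and> Poly_Mapping.keys V \<subseteq> Poly_Mapping.keys (latin_array M r (ext \<phi>))"
    if \<phi>: "\<phi> \<in> \<Phi>" for \<phi>
    using extreme_point_line_polytope_exists[of "latin_array M r (ext \<phi>)" "array_lines n"]
      latin_array_tristochastic[OF M, of "ext \<phi>"] ext[OF \<phi>] finite_array_line
    unfolding tristochastic_eq_line_polytope n_def by metis
  then obtain V where V: "\<And>\<phi>. \<phi> \<in> \<Phi> \<Longrightarrow> V \<phi> extreme_point_of tristochastic n"
    "\<And>\<phi>. \<phi> \<in> \<Phi> \<Longrightarrow> Poly_Mapping.keys (V \<phi>) \<subseteq> Poly_Mapping.keys (latin_array M r (ext \<phi>))"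
    by metis
  have face: "Poly_Mapping.lookup (V \<phi>) (idx M x a, idx M y b, idx M z c)
      = (if ext \<phi> (x, y, z) (a, b) = c then 1 / 2 else 0)"
    if "\<phi> \<in> \<Phi>" "design_cube x y z" "a \<in> {1..M}" "b \<in> {1..M}" "c \<in> {1..M}" for \<phi> x y z a b c
  proof (rule latin_array_face[OF M])
    show "V \<phi> \<in> tristochastic (7 * M + r)"
      using V(1)[OF that(1)] by (simp add: extreme_point_of_def n_def)
    show "ext \<phi> v = ext \<phi> w" if "v \<in> set odd_walk" "w \<in> set odd_walk" for v w
      using that by (simp add: ext_def F_def)
  qed (use that ext V(2) in simp_all)
  have "inj_on V \<Phi>"
  proof (rule inj_onI)
    fix \<phi> \<psi> assume mem: "\<phi> \<in> \<Phi>" "\<psi> \<in> \<Phi>" and eq: "V \<phi> = V \<psi>"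
    have "\<phi> w = \<psi> w" if w: "w \<in> F" for w
    proof -
      obtain x y z where xyz: "w = (x, y, z)" by (metis prod_cases3)
      have cube: "design_cube x y z" using w by (simp add: F_def design_cube_def xyz)
      have sq: "\<phi> w \<in> ({1..M} \<times> {1..M}) \<rightarrow>\<^sub>E {1..M}" "\<psi> w \<in> ({1..M} \<times> {1..M}) \<rightarrow>\<^sub>E {1..M}"
      proof -
        have "\<phi> w \<in> latin_squares M" "\<psi> w \<in> latin_squares M" 
          using mem w unfolding \<Phi>_def by (blast dest: PiE_mem)+
        then show "\<phi> w \<in> ({1..M} \<times> {1..M}) \<rightarrow>\<^sub>E {1..M}" "\<psi> w \<in> ({1..M} \<times> {1..M}) \<rightarrow>\<^sub>E {1..M}"
          by (simp_all add: latin_squares_def)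
      qed
      show ?thesis
      proof (rule PiE_ext[OF sq])
        fix p assume p: "p \<in> {1..M} \<times> {1..M}"
        obtain a b where ab: "p = (a, b)" by (cases p)
        define c where "c = \<phi> w (a, b)"
        have abc: "a \<in> {1..M}" "b \<in> {1..M}" "c \<in> {1..M}" using p sq(1) by (auto simp: ab c_def)
        have "ext \<phi> w (a, b) = c" using w by (simp add: ext_def c_def)
        then have "ext \<psi> w (a, b) = c"
          using face[OF mem(1) cube abc] face[OF mem(2) cube abc] eq by (simp add: xyz split: if_splits)
        then show "\<phi> w p = \<psi> w p" using w by (simp add: ext_def c_def ab)
      qed
    qed
    then show "\<phi> = \<psi>" using PiE_ext[of \<phi> F "\<lambda>_. latin_squares M" \<psi>] mem by (simp add: \<Phi>_def)
  qed
  moreover have "V ` \<Phi> \<subseteq> {A. A extreme_point_of tristochastic n}" using V(1) by auto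
  ultimately have "card \<Phi> \<le> card {A. A extreme_point_of tristochastic n}"
    using finite_extreme_points_tristochastic by (intro card_inj_on_le)
  moreover have "card \<Phi> = card (latin_squares M) ^ 77"
  proof -
    have "finite F" by (simp add: F_def)
    then show ?thesis by (simp add: \<Phi>_def card_funcsetE cardF)
  qed
  ultimately show ?thesis by (simp add: n_def)
qed

section \<open>Comparison of the exponents\<close>

lemma exponent_bound:
  fixes m a :: real
  assumes m: "1000 \<le> m" and a: "500 \<le> a"
  shows "3 / 2 * ((7 * m + 6)\<^sup>2 * (a + 10)) \<le> 77 * (m * (a - 4) * (63 / 64 * m))"
proof -
  \<comment> \<open>The gap between \<open>77 / 49\<close> and \<open>3 / 2\<close> pays for
    replacing \<open>49\<close> by \<open>49.1\<close>, for the factor \<open>63 / 64\<close> and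
    for the shift from \<open>a - 4\<close> to \<open>a + 10\<close>.\<close>
  have "1000 * m \<le> m * m" using m by (intro mult_right_mono) auto
  moreover have "(7 * m + 6)\<^sup>2 = 49 * (m * m) + 84 * m + 36" by (simp add: power2_eq_square algebra_simps)
  ultimately have "(7 * m + 6)\<^sup>2 \<le> 491 / 10 * (m * m)" using m by linarith
  then have "3 / 2 * ((7 * m + 6)\<^sup>2 * (a + 10)) \<le> 3 / 2 * (491 / 10 * (m * m) * (a + 10))"
    using a by (intro mult_left_mono mult_right_mono) auto
  also have "\<dots> = (m * m) * (3 / 2 * 491 / 10 * (a + 10))" by (simp add: algebra_simps)
  also have "\<dots> \<le> (m * m) * (77 * 63 / 64 * (a - 4))"
    using a by (intro mult_left_mono) auto
  also have "\<dots> = 77 * (m * (a - 4) * (63 / 64 * m))" by (simp add: algebra_simps)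
  finally show ?thesis .
qed

text \<open>Both sides are compared with powers of two, the left one through the crude upper bound
  and the right one through halving. Since \<open>77 / 49\<close> exceeds \<open>3 / 2\<close>
  strictly, no loss in the exponent remains for large \<open>n\<close>.\<close>

lemma latin_squares_power_bound:
  assumes n: "2 ^ 600 \<le> n" and r: "r < 7" "n = 7 * M + r"
  shows "real (card (latin_squares n)) powr (3 / 2) \<le> real (card (latin_squares M) ^ 77)"
proof -
  have nM: "n \<le> 7 * M + 6" using r by simp
  have M: "2 ^ 590 \<le> M"
  proof (rule ccontr)
    assume "\<not> 2 ^ 590 \<le> M"
    then have "n < 7 * 2 ^ 590 + 6" using nM by linarith
    moreover have "7 * 2 ^ 590 + 6 \<le> (2 :: nat) ^ 600" by simp
    ultimately show False using n by linarith
  qed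
  moreover have "(1000 :: nat) \<le> 2 ^ 590" by simp
  ultimately have M1: "1000 \<le> M" by linarith
  then obtain k where k: "2 ^ k \<le> M" "M < 2 ^ (k + 1)" using ex_power_ivl1[of 2 M] by auto
  have "(2 :: nat) ^ 590 < 2 ^ (k + 1)" using M k(2) by linarith
  then have k590: "590 < k + 1" by (rule power_less_imp_less_exp[rotated]) simp
  \<comment> \<open>Six binary digits are given up: \<open>D\<close> is at most
    \<open>M / 64\<close>, so rounding \<open>M\<close> down to a multiple of \<open>D\<close> loses
    less than \<open>M / 64\<close>.\<close>
  define a where "a = k - 6"
  define D where "D = (2 :: nat) ^ a"
  define h where "h = M div D"
  have a: "k = a + 6" "500 \<le> a" using k590 by (simp_all add: a_def)
  have D: "0 < D" "64 * D \<le> M" "M < 128 * D"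
    using k by (simp_all add: D_def a power_add)
  have Dh: "D * h \<le> M" by (simp add: h_def)
  have "M mod D < D" using D(1) by simp
  moreover have "D * h + M mod D = M" by (simp add: h_def)
  ultimately have "63 * M \<le> 64 * (D * h)" using D(2) by linarith
  then have Dh': "63 / 64 * real M \<le> real (D * h)" by linarith
  have "2 ^ (M * a * D * h) \<le> card (latin_squares M) * 2 ^ (4 * M * D * h)"
    using card_latin_squares_ge[of M a h] M1 Dh by (simp add: D_def)
  also have "M * a * D * h = M * (a - 4) * (D * h) + 4 * M * D * h"
  proof -
    have "a = (a - 4) + 4" using a by simp
    then have "M * a * D * h = M * ((a - 4) + 4) * D * h" by metis
    then show ?thesis by (simp only: algebra_simps)
  qed
  finally have LM: "2 ^ (M * (a - 4) * (D * h)) \<le> card (latin_squares M)"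
    by (simp add: power_add)
  have lower: "2 powr (77 * (real M * (real a - 4) * (63 / 64 * real M))) \<le> real (card (latin_squares M) ^ 77)"
  proof -
    have "77 * (real M * (real a - 4) * (63 / 64 * real M)) \<le> 77 * (real M * (real a - 4) * real (D * h))"
      using a Dh' by (intro mult_left_mono) auto
    also have "\<dots> = real (M * (a - 4) * (D * h) * 77)"
      using a by (simp add: of_nat_diff)
    finally have "2 powr (77 * (real M * (real a - 4) * (63 / 64 * real M)))
        \<le> 2 powr real (M * (a - 4) * (D * h) * 77)" by simp
    also have "\<dots> = real ((2 ^ (M * (a - 4) * (D * h))) ^ 77)"
      by (simp only: powr_realpow power_mult of_nat_power of_nat_numeral) 
    also have "\<dots> \<le> real (card (latin_squares M) ^ 77)"
      using LM by (intro of_nat_mono power_mono) simp_all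
    finally show ?thesis .
  qed
  have upper: "real (card (latin_squares n)) \<le> 2 powr ((7 * real M + 6)\<^sup>2 * (real a + 10))"
  proof -
    \<comment> \<open>From \<open>M < 128 * D\<close> one gets
      \<open>7 * M + 6 \<le> 8 * M < 2 ^ 10 * D\<close>.\<close>
    have "n \<le> 2 ^ (a + 10)" using nM D M1 by (simp add: D_def power_add)
    then have "n ^ (n * n) \<le> (2 ^ (a + 10)) ^ (n * n)" by (rule power_mono) simp
    then have "card (latin_squares n) \<le> (2 ^ (a + 10)) ^ (n * n)"
      using card_latin_squares_le[of n] by linarith
    then have "real (card (latin_squares n)) \<le> real ((2 ^ (a + 10)) ^ (n * n))" by (rule of_nat_mono)
    also have "\<dots> = 2 ^ ((a + 10) * (n * n))" by (simp only: power_mult of_nat_power of_nat_numeral)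
    also have "\<dots> = 2 powr real ((a + 10) * (n * n))" by (rule powr_realpow[symmetric]) simp
    also have "\<dots> \<le> 2 powr ((7 * real M + 6)\<^sup>2 * (real a + 10))"
    proof -
      have "real n \<le> 7 * real M + 6" using nM by linarith
      then have "real n * real n \<le> (7 * real M + 6)\<^sup>2" unfolding power2_eq_square by (intro mult_mono) auto
      then have "(real n * real n) * (real a + 10) \<le> (7 * real M + 6)\<^sup>2 * (real a + 10)"
        by (rule mult_right_mono) simp
      then show ?thesis by (simp add: mult.commute)
    qed
    finally show ?thesis .
  qed
  have "real (card (latin_squares n)) powr (3 / 2)
      \<le> (2 powr ((7 * real M + 6)\<^sup>2 * (real a + 10))) powr (3 / 2)"
    using upper by (intro powr_mono2) simp_all
  also have "\<dots> = 2 powr (3 / 2 * ((7 * real M + 6)\<^sup>2 * (real a + 10)))"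
    by (simp add: powr_powr mult.commute)
  also have "\<dots> \<le> 2 powr (77 * (real M * (real a - 4) * (63 / 64 * real M)))"
    using exponent_bound[of "real M" "real a"] M1 a by (intro powr_mono) simp_all
  also note lower
  finally show ?thesis .
qed

text \<open>The constant array \<open>1 / n\<close> shows that the polytope is nonempty, which
  settles the small \<open>n\<close>.\<close>

lemma tristochastic_extreme_point_exists:
  assumes "1 \<le> n"
  shows "{A. A extreme_point_of tristochastic n} \<noteq> {}"
proof -
  define N where "N = {1..n} \<times> {1..n} \<times> {1..n}"
  define f where "f p = (if p \<in> N then 1 / real n else 0)" for p
  have "finite {p. f p \<noteq> 0}"
    by (rule finite_subset[of _ N]) (auto simp: f_def N_def split: if_splits)
  then have lk: "Poly_Mapping.lookup (Abs_poly_mapping f) = f" by simp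
  have "Poly_Mapping.keys (Abs_poly_mapping f) \<subseteq> N"
    by (auto simp: in_keys_iff lk f_def split: if_splits)
  then have "Abs_poly_mapping f \<in> tristochastic n"
    unfolding tristochastic_def arrays3_def lk using assms by (simp add: f_def N_def)
  then show ?thesis
    unfolding tristochastic_eq_line_polytope
    using extreme_point_line_polytope_exists[of _ "array_lines n"] finite_array_line by blast
qed

theorem theorem5:
  shows "\<exists>\<epsilon> :: nat \<Rightarrow> real. \<epsilon> \<longlonglongrightarrow> 0 \<and>
    (\<forall>n\<ge>1. real (card {A. A extreme_point_of tristochastic n})
             \<ge> real (card (latin_squares n)) powr (3 / 2 - \<epsilon> n))"
proof (intro exI conjI allI impI)
  \<comment> \<open>Below \<open>2 ^ 600\<close> the exponent becomes zero and one vertex is enough;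
    from there on the exponent is exactly \<open>3 / 2\<close>.\<close>
  define \<epsilon> :: "nat \<Rightarrow> real" where "\<epsilon> n = (if n < 2 ^ 600 then 3 / 2 else 0)" for n
  have "eventually (\<lambda>n. \<epsilon> n = 0) sequentially"
    using eventually_ge_at_top[of "2 ^ 600 :: nat"] by eventually_elim (simp add: \<epsilon>_def)
  then show "\<epsilon> \<longlonglongrightarrow> 0" by (rule tendsto_eventually)
  fix n :: nat
  assume n: "1 \<le> n"
  show "real (card {A. A extreme_point_of tristochastic n})
      \<ge> real (card (latin_squares n)) powr (3 / 2 - \<epsilon> n)"
  proof (cases "n < 2 ^ 600")
    case True
    have "1 \<le> card {A. A extreme_point_of tristochastic n}"
      using tristochastic_extreme_point_exists[OF n] finite_extreme_points_tristochastic[of n]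
      by (simp add: Suc_le_eq card_gt_0_iff)
    then show ?thesis using True by (simp add: \<epsilon>_def)
  next
    case False
    define M r where "M = n div 7" and "r = n mod 7"
    have M: "n = 7 * M + r" "r < 7" by (simp_all add: M_def r_def)
    moreover have "(100 :: nat) \<le> 2 ^ 600" by simp
    ultimately have "0 < M" "r \<le> M" using False by linarith+
    then have "card (latin_squares M) ^ 77 \<le> card {A. A extreme_point_of tristochastic n}"
      using card_extreme_points_ge M(1) by simp
    then have "real (card (latin_squares M) ^ 77) \<le> real (card {A. A extreme_point_of tristochastic n})"
      by (rule of_nat_mono)
    moreover have "real (card (latin_squares n)) powr (3 / 2) \<le> real (card (latin_squares M) ^ 77)"
      using latin_squares_power_bound[of n r M] M False by simp
    ultimately have "real (card (latin_squares n)) powr (3 / 2) \<le> real (card {A. A extreme_point_of tristochastic n})"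
      by (rule order_trans[rotated])
    moreover have "\<epsilon> n = 0" using False by (simp add: \<epsilon>_def)
    ultimately show ?thesis by simp
  qed
qed

end
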